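(* Let $(\mathcal{E},\mathcal{D}(\mathcal{E}))$ be an irreducible regular Dirichlet form on $L^2(E;m)$, let $\mu$ be a signed smooth Radon measure such that $(\mathcal{E}^{\mu},\mathcal{D}(\mathcal{E})\cap C_c(E))$ is non-negative definite and closable, and let $\Phi$ be a Bernstein function with drift $b$ and Lévy measure $\nu$ such that either $b>0$ or $\inf \operatorname{supp}(\nu)=0$. If the Schrödinger form $(\mathcal{E}^{\mu},\mathcal{D}(\mathcal{E}^{\mu}))$ is critical and $$\int_0^\infty s\,d\nu(s)<\infty,$$ then the subordinated Schrödinger form $(\mathcal{E}^{\mu,\Phi},\mathcal{D}(\mathcal{E}^{\mu,\Phi}))$ is also critical.
   Context: Setting. $E$ is a locally compact separable metric space, $m$ a positive Radon measure on $E$ with full support, $\langle\cdot,\cdot\rangle_m$ the inner product of real $L^2(E;m)$. A Dirichlet form $(\mathcal{E},\mathcal{D}(\mathcal{E}))$ is a densely defined, non-negative definite, symmetric, closed bilinear form on $L^2(E;m)$ that is Markovian: $f\in\mathcal{D}(\mathcal{E})$ implies $g:=(0\vee f)\wedge1\in\mathcal{D}(\mathcal{E})$ and $\mathcal{E}(g,g)\le\mathcal{E}(f,f)$. Put $\mathcal{E}_1:=\mathcal{E}+\langle\cdot,\cdot\rangle_m$. It is regular if $\mathcal{D}(\mathcal{E})\cap C_c(E)$ is $\mathcal{E}_1$-dense in $\mathcal{D}(\mathcal{E})$ and sup-norm dense in $C_c(E)$ (continuous functions with compact support). With $\mathcal{L}$ the non-positive self-adjoint operator such that $\mathcal{D}(\mathcal{E})=\mathcal{D}(\sqrt{-\mathcal{L}})$,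 $\mathcal{E}(f,g)=\langle\sqrt{-\mathcal{L}}f,\sqrt{-\mathcal{L}}g\rangle_m$, and $T_t=e^{t\mathcal{L}}$, the form is irreducible if every measurable $A$ with $T_t(1_Af)=1_AT_tf$ for all $t>0$, $f\in L^2(E;m)$ satisfies $m(A)=0$ or $m(A^c)=0$. A nest is an increasing sequence of closed sets $F_k$ with $\bigcup_k\{f\in\mathcal{D}(\mathcal{E}): f=0\ m\text{-a.e. on }E\setminus F_k\}$ $\mathcal{E}_1$-dense in $\mathcal{D}(\mathcal{E})$; a set is $\mathcal{E}$-polar if it is contained in $\bigcap_k(E\setminus F_k)$ for some nest. A positive Borel measure is smooth if it charges no $\mathcal{E}$-polar set and is finite on each $F_k$ of some nest. A signed smooth Radon measure is $\mu=\mu^+-\mu^-$ with $\mu^\pm$ smooth Radon measures. Schrödinger form. $\mathcal{E}^\mu(f,g):=\mathcal{E}(f,g)+\int_E fg\,d\mu^+-\int_E fg\,d\mu^-$ for $f,g\in\mathcal{D}(\mathcal{E})\cap C_c(E)$. When this is non-negative definite and closable on $L^2(E;m)$, $(\mathcal{E}^\mu,\mathcal{D}(\mathcal{E}^\mu))$ denotes its closure, $\mathcal{L}^\mu$ ("$=\mathcal{L}-\mu$") the associated non-positive self-adjoint operator and $T_t^\mu=e^{t\mathcal{L}^\mu}$ (a positivity preserving semigroup). Subordination. A Bernstein function here is $\Phi(\lambda)=b\lambda+\int_0^\infty(1-e^{-\lambda s})\,\nu(ds)$ with $b\ge0$ and $\nu$ a Radon measure on $(0,\infty)$ with $\int_0^\infty(1\wedge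 s)\,\nu(ds)<\infty$. Put $\mathcal{L}^{\mu,\Phi}:=-\Phi(-\mathcal{L}^\mu)$; the subordinated Schrödinger form is $\mathcal{D}(\mathcal{E}^{\mu,\Phi})=\mathcal{D}(\sqrt{-\mathcal{L}^{\mu,\Phi}})$, $\mathcal{E}^{\mu,\Phi}(f,g)=\langle\sqrt{-\mathcal{L}^{\mu,\Phi}}f,\sqrt{-\mathcal{L}^{\mu,\Phi}}g\rangle_m$. Extended spaces and criticality. For $\mathcal{A}=\mathcal{E}^\mu$ or $\mathcal{A}=\mathcal{E}^{\mu,\Phi}$, $\mathcal{D}_e(\mathcal{A})$ is the set of ($m$-classes of) $m$-a.e. finite measurable $f$ for which there is an $\mathcal{A}$-Cauchy sequence $\{f_n\}\subset\mathcal{D}(\mathcal{A})$ with $f_n\to f$ $m$-a.e.; $\mathcal{A}(f,f):=\lim_n\mathcal{A}(f_n,f_n)$ (well defined). The form $(\mathcal{A},\mathcal{D}(\mathcal{A}))$ is critical if there is a strictly positive $h\in\mathcal{D}_e(\mathcal{A})$ with $\mathcal{A}(h,h)=0$. *)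

theory Defs
  imports "HOL-Analysis.Analysis"
begin

section \<open>Radon measures\<close>

text \<open>
  Radon measures on a subspace \<open>S\<close>: \<open>S = UNIV\<close> is used for the state space and
  \<open>S = {0<..}\<close> for Levy measures, which need not be finite near \<open>0\<close>.
\<close>

definition radon_on :: "'a::topological_space set \<Rightarrow> 'a measure \<Rightarrow> bool" where
  "radon_on S M \<longleftrightarrow>
     sets M = sets (restrict_space borel S) \<and>
     (\<forall>K. compact K \<and> K \<subseteq> S \<longrightarrow> emeasure M K < \<infinity>) \<and>
     (\<forall>B\<in>sets M. emeasure M B = (SUP K\<in>{K. compact K \<and> K \<subseteq> B}. emeasure M K))"

definition supp_measure :: "'a::topological_space measure \<Rightarrow> 'a set" where
  "supp_measure M =
     {x \<in> space M. \<forall>U. open U \<and> x \<in> U \<longrightarrow> emeasure M (U \<inter> space M) > 0}"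

section \<open>The space \<open>L\<^sup>2(E;m)\<close>\<close>

text \<open>
  Elements of \<open>L\<^sup>2(E;m)\<close> are handled through measurable representatives. Sets of
  \<open>L\<^sup>2\<close>-elements are therefore closed under \<open>m\<close>-a.e. equality, and forms and operators
  respect it.
\<close>

definition L2 :: "'a measure \<Rightarrow> ('a \<Rightarrow> real) set" where
  "L2 M = {f \<in> borel_measurable M. integrable M (\<lambda>x. (f x)\<^sup>2)}"

definition ip :: "'a measure \<Rightarrow> ('a \<Rightarrow> real) \<Rightarrow> ('a \<Rightarrow> real) \<Rightarrow> real" where
  "ip M f g = (\<integral>x. f x * g x \<partial>M)"

definition L2_tendsto :: "'a measure \<Rightarrow> (nat \<Rightarrow> 'a \<Rightarrow> real) \<Rightarrow> ('a \<Rightarrow> real) \<Rightarrow> bool" where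
  "L2_tendsto M fn f \<longleftrightarrow>
     (\<lambda>n. ip M (\<lambda>x. fn n x - f x) (\<lambda>x. fn n x - f x)) \<longlonglongrightarrow> 0"

definition L2_subspace :: "'a measure \<Rightarrow> ('a \<Rightarrow> real) set \<Rightarrow> bool" where
  "L2_subspace M D \<longleftrightarrow>
     D \<subseteq> L2 M \<and> (\<lambda>x. 0) \<in> D \<and>
     (\<forall>f\<in>D. \<forall>g\<in>D. (\<lambda>x. f x + g x) \<in> D) \<and>
     (\<forall>c. \<forall>f\<in>D. (\<lambda>x. c * f x) \<in> D) \<and>
     (\<forall>f\<in>D. \<forall>g\<in>L2 M. (AE x in M. f x = g x) \<longrightarrow> g \<in> D)"

section \<open>Dirichlet forms\<close>

text \<open>A form is given by its domain \<open>D\<close> and a function \<open>A\<close> that is only relevant on \<open>D\<close>.\<close>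

type_synonym 'a form = "('a \<Rightarrow> real) \<Rightarrow> ('a \<Rightarrow> real) \<Rightarrow> real"

definition form1 :: "'a measure \<Rightarrow> 'a form \<Rightarrow> 'a form" where
  "form1 M A f g = A f g + ip M f g"

definition form_Cauchy :: "'a form \<Rightarrow> (nat \<Rightarrow> 'a \<Rightarrow> real) \<Rightarrow> bool" where
  "form_Cauchy A fn \<longleftrightarrow>
     (\<forall>e>0. \<exists>N. \<forall>i\<ge>N. \<forall>j\<ge>N. A (\<lambda>x. fn i x - fn j x) (\<lambda>x. fn i x - fn j x) < e)"

definition form_dense :: "'a form \<Rightarrow> ('a \<Rightarrow> real) set \<Rightarrow> ('a \<Rightarrow> real) set \<Rightarrow> bool" where
  "form_dense A S D \<longleftrightarrow>
     S \<subseteq> D \<and> (\<forall>f\<in>D. \<forall>e>0. \<exists>g\<in>S. A (\<lambda>x. f x - g x) (\<lambda>x. f x - g x) < e)"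

definition symmetric_bilinear_form :: "('a \<Rightarrow> real) set \<Rightarrow> 'a form \<Rightarrow> bool" where
  "symmetric_bilinear_form D A \<longleftrightarrow>
     (\<forall>f\<in>D. \<forall>g\<in>D. A f g = A g f) \<and>
     (\<forall>f\<in>D. \<forall>g\<in>D. \<forall>h\<in>D. A (\<lambda>x. f x + g x) h = A f h + A g h) \<and>
     (\<forall>c. \<forall>f\<in>D. \<forall>h\<in>D. A (\<lambda>x. c * f x) h = c * A f h)"

definition nonneg_form :: "('a \<Rightarrow> real) set \<Rightarrow> 'a form \<Rightarrow> bool" where
  "nonneg_form D A \<longleftrightarrow> (\<forall>f\<in>D. 0 \<le> A f f)"

definition closed_form :: "'a measure \<Rightarrow> ('a \<Rightarrow> real) set \<Rightarrow> 'a form \<Rightarrow> bool" where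
  "closed_form M D A \<longleftrightarrow>
     (\<forall>fn. (\<forall>n. fn n \<in> D) \<and> form_Cauchy (form1 M A) fn \<longrightarrow>
        (\<exists>f\<in>D. (\<lambda>n. form1 M A (\<lambda>x. fn n x - f x) (\<lambda>x. fn n x - f x)) \<longlonglongrightarrow> 0))"

definition markovian_form :: "('a \<Rightarrow> real) set \<Rightarrow> 'a form \<Rightarrow> bool" where
  "markovian_form D A \<longleftrightarrow>
     (\<forall>f\<in>D. let g = (\<lambda>x. min (max 0 (f x)) 1) in g \<in> D \<and> A g g \<le> A f f)"

definition dirichlet_form :: "'a measure \<Rightarrow> ('a \<Rightarrow> real) set \<Rightarrow> 'a form \<Rightarrow> bool" where
  "dirichlet_form M D A \<longleftrightarrow>
     L2_subspace M D \<and>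
     (\<forall>f\<in>D. \<forall>f'\<in>D. \<forall>g\<in>D. (AE x in M. f x = f' x) \<longrightarrow> A f g = A f' g) \<and>
     form_dense (ip M) D (L2 M) \<and>
     symmetric_bilinear_form D A \<and> nonneg_form D A \<and> closed_form M D A \<and>
     markovian_form D A"

definition Cc :: "('a::topological_space \<Rightarrow> real) set" where
  "Cc = {f. continuous_on UNIV f \<and> compact (closure {x. f x \<noteq> 0})}"

definition regular_form ::
    "'a::topological_space measure \<Rightarrow> ('a \<Rightarrow> real) set \<Rightarrow> 'a form \<Rightarrow> bool" where
  "regular_form M D A \<longleftrightarrow>
     form_dense (form1 M A) (D \<inter> Cc) D \<and>
     (\<forall>f\<in>Cc. \<forall>e>0. \<exists>g\<in>D \<inter> Cc. \<forall>x. \<bar>f x - g x\<bar> < e)"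

section \<open>Self-adjoint operators and functional calculus\<close>

text \<open>
  An unbounded operator on \<open>L\<^sup>2\<close> is its graph on representatives. The adjoint of a
  densely defined operator is again such a graph; \<open>adjoint_op M T = T\<close> makes \<open>T\<close> linear,
  single-valued modulo a.e. equality, and closed under a.e. equality.
\<close>

type_synonym 'a op = "(('a \<Rightarrow> real) \<times> ('a \<Rightarrow> real)) set"

definition neg_op :: "'a op \<Rightarrow> 'a op" where
  "neg_op T = {(f, \<lambda>x. - g x) | f g. (f, g) \<in> T}"

definition adjoint_op :: "'a measure \<Rightarrow> 'a op \<Rightarrow> 'a op" where
  "adjoint_op M T = {(g, h). g \<in> L2 M \<and> h \<in> L2 M \<and> (\<forall>(f, Tf)\<in>T. ip M Tf g = ip M f h)}"

definition self_adjoint_op :: "'a measure \<Rightarrow> 'a op \<Rightarrow> bool" where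
  "self_adjoint_op M T \<longleftrightarrow> form_dense (ip M) (Domain T) (L2 M) \<and> adjoint_op M T = T"

definition nonpos_op :: "'a measure \<Rightarrow> 'a op \<Rightarrow> bool" where
  "nonpos_op M T \<longleftrightarrow> (\<forall>(f, g)\<in>T. ip M g f \<le> 0)"

text \<open>
  Projection-valued measures on the real line. Each \<open>P B\<close> is symmetric, hence linear and
  compatible with a.e. equality, and idempotent by multiplicativity.
\<close>

definition projection_valued_measure ::
    "'a measure \<Rightarrow> (real set \<Rightarrow> ('a \<Rightarrow> real) \<Rightarrow> ('a \<Rightarrow> real)) \<Rightarrow> bool" where
  "projection_valued_measure M P \<longleftrightarrow>
     (\<forall>B\<in>sets borel. \<forall>f\<in>L2 M. P B f \<in> L2 M) \<and>
     (\<forall>B\<in>sets borel. \<forall>f\<in>L2 M. \<forall>g\<in>L2 M. ip M (P B f) g = ip M f (P B g)) \<and>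
     (\<forall>f\<in>L2 M. AE x in M. P UNIV f x = f x) \<and>
     (\<forall>B\<in>sets borel. \<forall>C\<in>sets borel. \<forall>f\<in>L2 M.
        AE x in M. P (B \<inter> C) f x = P B (P C f) x) \<and>
     (\<forall>B f. range B \<subseteq> sets borel \<and> disjoint_family B \<and> f \<in> L2 M \<longrightarrow>
        L2_tendsto M (\<lambda>n x. \<Sum>i<n. P (B i) f x) (P (\<Union>i. B i) f))"

text \<open>The scalar spectral measure \<open>B \<mapsto> \<langle>P B f, f\<rangle>\<close>.\<close>

definition spectral_measure ::
    "'a measure \<Rightarrow> (real set \<Rightarrow> ('a \<Rightarrow> real) \<Rightarrow> ('a \<Rightarrow> real)) \<Rightarrow> ('a \<Rightarrow> real) \<Rightarrow> real measure" where
  "spectral_measure M P f = measure_of UNIV (sets borel) (\<lambda>B. ennreal (ip M (P B f) f))"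

definition spectral_domain ::
    "'a measure \<Rightarrow> (real set \<Rightarrow> ('a \<Rightarrow> real) \<Rightarrow> ('a \<Rightarrow> real)) \<Rightarrow> (real \<Rightarrow> real) \<Rightarrow> ('a \<Rightarrow> real) set" where
  "spectral_domain M P \<phi> = {f \<in> L2 M. integrable (spectral_measure M P f) (\<lambda>l. (\<phi> l)\<^sup>2)}"

text \<open>
  The operator \<open>\<integral> \<phi> dP\<close>, that is \<open>\<langle>(\<integral> \<phi> dP) f, h\<rangle> = \<integral> \<phi> d\<langle>P f, h\<rangle>\<close>, where the signed measure
  \<open>\<langle>P f, h\<rangle>\<close> is written by polarization. Testing with \<open>h\<close> in the (dense) domain suffices, and
  makes both integrals converge.
\<close>

definition spectral_integral ::
    "'a measure \<Rightarrow> (real set \<Rightarrow> ('a \<Rightarrow> real) \<Rightarrow> ('a \<Rightarrow> real)) \<Rightarrow> (real \<Rightarrow> real) \<Rightarrow> 'a op" where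
  "spectral_integral M P \<phi> =
     {(f, g). f \<in> spectral_domain M P \<phi> \<and> g \<in> L2 M \<and>
        (\<forall>h\<in>spectral_domain M P \<phi>.
           ip M g h = ((\<integral>l. \<phi> l \<partial>spectral_measure M P (\<lambda>x. f x + h x))
                     - (\<integral>l. \<phi> l \<partial>spectral_measure M P (\<lambda>x. f x - h x))) / 4)}"

text \<open>
  \<open>functional_calculus M T \<phi> S\<close> says \<open>S = \<phi>(T)\<close>. By the spectral theorem a self-adjoint \<open>T\<close>
  has exactly one spectral resolution \<open>P\<close> (modulo a.e. equality).
\<close>

definition functional_calculus :: "'a measure \<Rightarrow> 'a op \<Rightarrow> (real \<Rightarrow> real) \<Rightarrow> 'a op \<Rightarrow> bool" where
  "functional_calculus M T \<phi> S \<longleftrightarrow>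
     (\<exists>P. projection_valued_measure M P \<and>
          T = spectral_integral M P (\<lambda>l. l) \<and> S = spectral_integral M P \<phi>)"

text \<open>
  \<open>L\<close> is the non-positive self-adjoint operator of the form \<open>(A, D)\<close>:
  \<open>D = D(sqrt(-L))\<close> and \<open>A(f,g) = \<langle>sqrt(-L) f, sqrt(-L) g\<rangle>\<close>.
\<close>

definition form_operator :: "'a measure \<Rightarrow> ('a \<Rightarrow> real) set \<Rightarrow> 'a form \<Rightarrow> 'a op \<Rightarrow> bool" where
  "form_operator M D A L \<longleftrightarrow>
     self_adjoint_op M L \<and> nonpos_op M L \<and>
     (\<exists>R. functional_calculus M (neg_op L) sqrt R \<and>
          D = Domain R \<and> (\<forall>(f, f')\<in>R. \<forall>(g, g')\<in>R. A f g = ip M f' g'))"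

definition irreducible_form :: "'a measure \<Rightarrow> ('a \<Rightarrow> real) set \<Rightarrow> 'a form \<Rightarrow> bool" where
  "irreducible_form M D A \<longleftrightarrow>
     (\<exists>L T. form_operator M D A L \<and>
        (\<forall>t>0. functional_calculus M L (\<lambda>l. exp (t * l)) (T t)) \<and>
        (\<forall>B\<in>sets M.
           (\<forall>t>0. \<forall>(f, g)\<in>T t. (\<lambda>x. indicator B x * f x, \<lambda>x. indicator B x * g x) \<in> T t) \<longrightarrow>
           emeasure M B = 0 \<or> emeasure M (space M - B) = 0))"

section \<open>Smooth measures\<close>

definition nest ::
    "'a::topological_space measure \<Rightarrow> ('a \<Rightarrow> real) set \<Rightarrow> 'a form \<Rightarrow> (nat \<Rightarrow> 'a set) \<Rightarrow> bool" where
  "nest M D A F \<longleftrightarrow>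
     incseq F \<and> (\<forall>k. closed (F k)) \<and>
     form_dense (form1 M A) (\<Union>k. {f \<in> D. AE x in M. x \<notin> F k \<longrightarrow> f x = 0}) D"

definition polar_set ::
    "'a::topological_space measure \<Rightarrow> ('a \<Rightarrow> real) set \<Rightarrow> 'a form \<Rightarrow> 'a set \<Rightarrow> bool" where
  "polar_set M D A N \<longleftrightarrow> (\<exists>F. nest M D A F \<and> N \<subseteq> (\<Inter>k. - F k))"

definition smooth_measure ::
    "'a::topological_space measure \<Rightarrow> ('a \<Rightarrow> real) set \<Rightarrow> 'a form \<Rightarrow> 'a measure \<Rightarrow> bool" where
  "smooth_measure M D A \<mu> \<longleftrightarrow>
     sets \<mu> = sets borel \<and>
     (\<forall>N\<in>sets borel. polar_set M D A N \<longrightarrow> emeasure \<mu> N = 0) \<and>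
     (\<exists>F. nest M D A F \<and> (\<forall>k. emeasure \<mu> (F k) < \<infinity>))"

section \<open>Schroedinger forms\<close>

text \<open>
  The signed measure is given by the pair \<open>\<mu>p, \<mu>n\<close> with \<open>\<mu> = \<mu>p - \<mu>n\<close>. The form on the core uses
  the continuous representatives, as \<open>\<mu>p\<close> and \<open>\<mu>n\<close> may be singular to \<open>m\<close>.
\<close>

definition schroedinger_core_form ::
    "'a form \<Rightarrow> 'a measure \<Rightarrow> 'a measure \<Rightarrow> 'a form" where
  "schroedinger_core_form A \<mu>p \<mu>n f g =
     A f g + (\<integral>x. f x * g x \<partial>\<mu>p) - (\<integral>x. f x * g x \<partial>\<mu>n)"

definition closable_form :: "'a measure \<Rightarrow> ('a \<Rightarrow> real) set \<Rightarrow> 'a form \<Rightarrow> bool" where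
  "closable_form M C A \<longleftrightarrow>
     (\<forall>fn. (\<forall>n. fn n \<in> C) \<and> form_Cauchy A fn \<and> L2_tendsto M fn (\<lambda>x. 0) \<longrightarrow>
        (\<lambda>n. A (fn n) (fn n)) \<longlonglongrightarrow> 0)"

definition closure_seq ::
    "'a measure \<Rightarrow> ('a \<Rightarrow> real) set \<Rightarrow> 'a form \<Rightarrow> (nat \<Rightarrow> 'a \<Rightarrow> real) \<Rightarrow> ('a \<Rightarrow> real) \<Rightarrow> bool" where
  "closure_seq M C A fn f \<longleftrightarrow>
     (\<forall>n. fn n \<in> C) \<and> form_Cauchy A fn \<and> L2_tendsto M fn f"

definition closure_dom :: "'a measure \<Rightarrow> ('a \<Rightarrow> real) set \<Rightarrow> 'a form \<Rightarrow> ('a \<Rightarrow> real) set" where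
  "closure_dom M C A = {f \<in> L2 M. \<exists>fn. closure_seq M C A fn f}"

definition closure_form :: "'a measure \<Rightarrow> ('a \<Rightarrow> real) set \<Rightarrow> 'a form \<Rightarrow> 'a form" where
  "closure_form M C A f g =
     (THE c. \<forall>fn gn. closure_seq M C A fn f \<and> closure_seq M C A gn g \<longrightarrow>
        (\<lambda>n. A (fn n) (gn n)) \<longlonglongrightarrow> c)"

definition schroedinger_dom ::
    "'a::topological_space measure \<Rightarrow> ('a \<Rightarrow> real) set \<Rightarrow> 'a form \<Rightarrow> 'a measure \<Rightarrow> 'a measure \<Rightarrow>
     ('a \<Rightarrow> real) set" where
  "schroedinger_dom M D A \<mu>p \<mu>n = closure_dom M (D \<inter> Cc) (schroedinger_core_form A \<mu>p \<mu>n)"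

definition schroedinger_form ::
    "'a::topological_space measure \<Rightarrow> ('a \<Rightarrow> real) set \<Rightarrow> 'a form \<Rightarrow> 'a measure \<Rightarrow> 'a measure \<Rightarrow>
     'a form" where
  "schroedinger_form M D A \<mu>p \<mu>n = closure_form M (D \<inter> Cc) (schroedinger_core_form A \<mu>p \<mu>n)"

section \<open>Bernstein functions and subordination\<close>

definition levy_pair :: "real \<Rightarrow> real measure \<Rightarrow> bool" where
  "levy_pair b \<nu> \<longleftrightarrow>
     0 \<le> b \<and> radon_on {0<..} \<nu> \<and> (\<integral>\<^sup>+ s. ennreal (min 1 s) \<partial>\<nu>) < \<infinity>"

definition bernstein :: "real \<Rightarrow> real measure \<Rightarrow> real \<Rightarrow> real" where
  "bernstein b \<nu> l = b * l + (\<integral>s. (1 - exp (- l * s)) \<partial>\<nu>)"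

text \<open>
  \<open>(A', D')\<close> is the form of \<open>-\<Phi>(-L)\<close>, where \<open>L\<close> is the operator of \<open>(A, D)\<close>. The form
  \<open>(A', D')\<close> is determined by \<open>(A, D)\<close> and \<open>\<Phi>\<close> (\<open>A'\<close> on \<open>D' \<times> D'\<close>, the only place where it
  is used).
\<close>

definition subordinate_form ::
    "'a measure \<Rightarrow> (real \<Rightarrow> real) \<Rightarrow> ('a \<Rightarrow> real) set \<Rightarrow> 'a form \<Rightarrow> ('a \<Rightarrow> real) set \<Rightarrow> 'a form \<Rightarrow> bool"
  where
  "subordinate_form M \<Phi> D A D' A' \<longleftrightarrow>
     (\<exists>L L'. form_operator M D A L \<and>
        functional_calculus M (neg_op L) \<Phi> (neg_op L') \<and>
        form_operator M D' A' L')"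

section \<open>Extended spaces and criticality\<close>

definition extended_seq ::
    "'a measure \<Rightarrow> ('a \<Rightarrow> real) set \<Rightarrow> 'a form \<Rightarrow> (nat \<Rightarrow> 'a \<Rightarrow> real) \<Rightarrow> ('a \<Rightarrow> real) \<Rightarrow> bool" where
  "extended_seq M D A fn f \<longleftrightarrow>
     (\<forall>n. fn n \<in> D) \<and> form_Cauchy A fn \<and> (AE x in M. (\<lambda>n. fn n x) \<longlonglongrightarrow> f x)"

definition extended_dom :: "'a measure \<Rightarrow> ('a \<Rightarrow> real) set \<Rightarrow> 'a form \<Rightarrow> ('a \<Rightarrow> real) set" where
  "extended_dom M D A = {f \<in> borel_measurable M. \<exists>fn. extended_seq M D A fn f}"

text \<open>
  \<open>extended_value M D A f c\<close> says \<open>A(f,f) = c\<close> for \<open>f\<close> in the extended space. For the forms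
  considered here the limit does not depend on the approximating sequence.
\<close>

definition extended_value ::
    "'a measure \<Rightarrow> ('a \<Rightarrow> real) set \<Rightarrow> 'a form \<Rightarrow> ('a \<Rightarrow> real) \<Rightarrow> real \<Rightarrow> bool" where
  "extended_value M D A f c \<longleftrightarrow>
     (\<exists>fn. extended_seq M D A fn f \<and> (\<lambda>n. A (fn n) (fn n)) \<longlonglongrightarrow> c)"

definition critical_form :: "'a measure \<Rightarrow> ('a \<Rightarrow> real) set \<Rightarrow> 'a form \<Rightarrow> bool" where
  "critical_form M D A \<longleftrightarrow>
     (\<exists>h\<in>extended_dom M D A. (AE x in M. 0 < h x) \<and> extended_value M D A h 0)"

end

(* Since 1 - exp (- l s) <= l s, a Levy measure with finite first moment satisfies
   Phi(l) <= C l with C = b + integral of s. By the spectral theorem the subordinated form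
   is therefore dominated by a multiple of the Schroedinger form on a larger domain, and
   an approximating sequence of the ground state h along which the Schroedinger form tends
   to 0 does the same for the subordinated form. *)

theory Submission
  imports Defs
begin

section \<open>The space \<open>L\<^sup>2\<close>\<close>

text \<open>The obstacle is that spectral resolutions enter only through existential statements,
  three times: for the form of \<open>L\<close>, for the relation between \<open>L\<close> and
  \<open>L'\<close>, and for the form of \<open>L'\<close>. The bound on \<Phi> can therefore not be
  integrated against one common measure. Instead of proving that resolutions are unique, the
  argument uses what they share, the graphs \<open>neg_op L\<close> and \<open>neg_op L'\<close>:
  the numbers <-L g, g> and <-L' g, g> do not depend on a resolution, and for g in the domain of -L
  they are integrals against each resolution concerned. This needs a small spectral calculus for an
  arbitrary resolution: every vector of the maximal domain of \<integral> \<phi> dP has an image,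
  unique up to null sets, whose norm and quadratic form are integrals against the scalar spectral
  measure. A general f in the form domain is reached as an L2 limit of its spectral truncations.
  That limit costs a constant factor, which is harmless because criticality only asks for form
  values tending to 0.\<close>

lemma L2_measurable: "f \<in> L2 M \<Longrightarrow> f \<in> borel_measurable M"
  by (simp add: L2_def)

lemma L2_integrable_mult:
  assumes "f \<in> L2 M" "g \<in> L2 M"
  shows "integrable M (\<lambda>x. f x * g x)"
proof (rule Bochner_Integration.integrable_bound)
  show "integrable M (\<lambda>x. (f x)\<^sup>2 + (g x)\<^sup>2)" using assms by (simp add: L2_def)
  show "(\<lambda>x. f x * g x) \<in> borel_measurable M"
    using assms[THEN L2_measurable] by measurable
  have "\<bar>f x * g x\<bar> \<le> (f x)\<^sup>2 + (g x)\<^sup>2" for x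
  proof -
    have "0 \<le> (\<bar>f x\<bar> - \<bar>g x\<bar>)\<^sup>2" by simp
    then have "2 * \<bar>f x * g x\<bar> \<le> (f x)\<^sup>2 + (g x)\<^sup>2"
      by (simp add: power2_eq_square algebra_simps abs_mult)
    then show ?thesis using abs_ge_zero[of "f x * g x"] by linarith
  qed
  then show "AE x in M. norm (f x * g x) \<le> norm ((f x)\<^sup>2 + (g x)\<^sup>2)" by simp
qed

lemma L2_add:
  assumes "f \<in> L2 M" "g \<in> L2 M"
  shows "(\<lambda>x. f x + g x) \<in> L2 M"
proof -
  have "integrable M (\<lambda>x. (f x)\<^sup>2 + 2 * (f x * g x) + (g x)\<^sup>2)"
    using assms L2_integrable_mult[OF assms] by (simp add: L2_def)
  moreover have "(\<lambda>x. (f x)\<^sup>2 + 2 * (f x * g x) + (g x)\<^sup>2) = (\<lambda>x. (f x + g x)\<^sup>2)"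
    by (simp add: power2_eq_square algebra_simps)
  ultimately show ?thesis using assms by (auto simp: L2_def)
qed

lemma L2_scale:
  assumes "f \<in> L2 M"
  shows "(\<lambda>x. c * f x) \<in> L2 M"
  using assms by (auto simp: L2_def power_mult_distrib)

lemma L2_diff:
  assumes "f \<in> L2 M" "g \<in> L2 M"
  shows "(\<lambda>x. f x - g x) \<in> L2 M"
  using L2_add[OF assms(1) L2_scale[OF assms(2), of "-1"]] by simp

lemma L2_zero: "(\<lambda>x. 0) \<in> L2 M"
  by (simp add: L2_def)

lemma L2_sum:
  assumes "\<And>i. i \<in> I \<Longrightarrow> f i \<in> L2 M"
  shows "(\<lambda>x. \<Sum>i\<in>I. f i x) \<in> L2 M"
  using assms
proof (induction I rule: infinite_finite_induct)
  case (insert i I)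
  then show ?case by (simp add: L2_add)
qed (simp_all add: L2_zero)

lemmas L2_intros = L2_add L2_diff L2_scale L2_zero L2_sum

lemma ip_commute: "ip M f g = ip M g f"
  by (simp add: ip_def mult.commute)

lemma ip_add_left:
  assumes "f \<in> L2 M" "g \<in> L2 M" "h \<in> L2 M"
  shows "ip M (\<lambda>x. f x + g x) h = ip M f h + ip M g h"
  using assms by (simp add: ip_def ring_distribs L2_integrable_mult)

lemma ip_diff_left:
  assumes "f \<in> L2 M" "g \<in> L2 M" "h \<in> L2 M"
  shows "ip M (\<lambda>x. f x - g x) h = ip M f h - ip M g h"
  using assms by (simp add: ip_def ring_distribs L2_integrable_mult)

lemma ip_scale_left: "ip M (\<lambda>x. c * f x) h = c * ip M f h"
  by (simp add: ip_def mult.assoc)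

lemma ip_sum_left:
  assumes "\<And>i. i \<in> I \<Longrightarrow> f i \<in> L2 M" "h \<in> L2 M"
  shows "ip M (\<lambda>x. \<Sum>i\<in>I. f i x) h = (\<Sum>i\<in>I. ip M (f i) h)"
  using assms by (simp add: ip_def sum_distrib_right L2_integrable_mult)

lemma ip_add_right:
  assumes "f \<in> L2 M" "g \<in> L2 M" "h \<in> L2 M"
  shows "ip M h (\<lambda>x. f x + g x) = ip M h f + ip M h g"
  using ip_add_left[OF assms] by (simp add: ip_commute)

lemma ip_diff_right:
  assumes "f \<in> L2 M" "g \<in> L2 M" "h \<in> L2 M"
  shows "ip M h (\<lambda>x. f x - g x) = ip M h f - ip M h g"
  using ip_diff_left[OF assms] by (simp add: ip_commute)

lemma ip_scale_right: "ip M h (\<lambda>x. c * f x) = c * ip M h f"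
  using ip_scale_left[of M c f h] by (simp add: ip_commute)

lemmas ip_linear = ip_add_left ip_add_right ip_diff_left ip_diff_right
  ip_scale_left ip_scale_right

lemma ip_self_nonneg: "0 \<le> ip M f f"
  by (simp add: ip_def)

lemma ip_diff_self:
  assumes "f \<in> L2 M" "g \<in> L2 M"
  shows "ip M (\<lambda>x. f x - g x) (\<lambda>x. f x - g x) = ip M f f - 2 * ip M f g + ip M g g"
  using assms by (simp add: ip_linear L2_intros ip_commute[of M g f])

lemma ip_self_eq_0:
  assumes "f \<in> L2 M" "ip M f f = 0"
  shows "AE x in M. f x = 0"
proof -
  have "integrable M (\<lambda>x. f x * f x)" using assms by (simp add: L2_integrable_mult)
  then show ?thesis
    using assms(2) integral_nonneg_eq_0_iff_AE[of M "\<lambda>x. f x * f x"] by (simp add: ip_def)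
qed

lemma ip_cong_AE:
  assumes "f \<in> L2 M" "f' \<in> L2 M" "g \<in> L2 M" "AE x in M. f x = f' x"
  shows "ip M f g = ip M f' g"
  unfolding ip_def
  using assms(4) assms(1-3)[THEN L2_measurable] by (intro integral_cong_AE) auto

section \<open>Cauchy-Schwarz, continuity of the inner product, completeness\<close>

lemma ip_Cauchy_Schwarz:
  assumes "f \<in> L2 M" "g \<in> L2 M"
  shows "(ip M f g)\<^sup>2 \<le> ip M f f * ip M g g"
proof -
  have q: "0 \<le> ip M f f - 2 * t * ip M f g + t\<^sup>2 * ip M g g" for t
    using ip_self_nonneg[of M "\<lambda>x. f x - t * g x"] assms
    by (simp add: ip_diff_self L2_intros ip_linear power2_eq_square mult.assoc)
  show ?thesis
  proof (cases "ip M g g = 0")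
    case True
    have "ip M f g = 0"
    proof (rule ccontr)
      assume *: "ip M f g \<noteq> 0"
      \<comment> \<open>With <g,g> = 0 the quadratic in \<open>q\<close> is affine in t; this t
        gives it the value -<f,f> - 2 < 0.\<close>
      have "0 \<le> ip M f f - 2 * ((ip M f f + 1) / ip M f g) * ip M f g"
        using q[of "(ip M f f + 1) / ip M f g"] True by simp
      then show False using * ip_self_nonneg[of M f] by simp
    qed
    then show ?thesis by (simp add: True)
  next
    case False
    then have pos: "ip M g g > 0" using ip_self_nonneg[of M g] by linarith
    have "0 \<le> (ip M f f - 2 * (ip M f g / ip M g g) * ip M f g
        + (ip M f g / ip M g g)\<^sup>2 * ip M g g) * ip M g g"
      using q[of "ip M f g / ip M g g"] pos by simp
    also have "\<dots> = ip M f f * ip M g g - (ip M f g)\<^sup>2"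
      using pos by (simp add: field_simps power2_eq_square)
    finally show ?thesis by simp
  qed
qed

lemma L2_tendsto_ip:
  assumes "\<And>n. fn n \<in> L2 M" "f \<in> L2 M" "h \<in> L2 M" "L2_tendsto M fn f"
  shows "(\<lambda>n. ip M (fn n) h) \<longlonglongrightarrow> ip M f h"
proof -
  let ?d = "\<lambda>n x. fn n x - f x"
  have "(\<lambda>n. (ip M (?d n) h)\<^sup>2) \<longlonglongrightarrow> 0"
  proof (rule tendsto_sandwich[where f = "\<lambda>_. 0"])
    show "\<forall>\<^sub>F n in sequentially. (ip M (?d n) h)\<^sup>2 \<le> ip M (?d n) (?d n) * ip M h h"
      using assms by (intro always_eventually allI ip_Cauchy_Schwarz L2_diff) auto
    show "(\<lambda>n. ip M (?d n) (?d n) * ip M h h) \<longlonglongrightarrow> 0"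
      using tendsto_mult_left_zero assms(4) unfolding L2_tendsto_def by blast
  qed auto
  then have "(\<lambda>n. ip M (?d n) h) \<longlonglongrightarrow> 0"
    by simp
  then have "(\<lambda>n. ip M (?d n) h + ip M f h) \<longlonglongrightarrow> 0 + ip M f h"
    by (intro tendsto_add tendsto_const)
  then show ?thesis using assms by (simp add: ip_linear)
qed

lemma L2_tendsto_ip_self:
  assumes "\<And>n. fn n \<in> L2 M" "f \<in> L2 M" "L2_tendsto M fn f"
  shows "(\<lambda>n. ip M (fn n) (fn n)) \<longlonglongrightarrow> ip M f f"
proof -
  let ?d = "\<lambda>n x. fn n x - f x"
  have "(\<lambda>n. ip M (?d n) (?d n) + 2 * ip M (fn n) f - ip M f f)
      \<longlonglongrightarrow> 0 + 2 * ip M f f - ip M f f"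
    using assms L2_tendsto_ip[OF assms(1,2,2,3)]
    by (intro tendsto_intros) (auto simp: L2_tendsto_def)
  then show ?thesis using assms by (simp add: ip_diff_self)
qed

text \<open>
  Along a subsequence with \<open>\<parallel>d\<^sub>k\<parallel>\<^sup>2 \<le> 4\<^sup>-\<^sup>k\<close> for the increments \<open>d\<^sub>k\<close>, the function
  \<open>\<Sum>k. 2\<^sup>k d\<^sub>k\<^sup>2\<close> is integrable, so a.e. \<open>d\<^sub>k = O(2\<^sup>-\<^sup>k\<^sup>/\<^sup>2)\<close>.
\<close>

lemma L2_fast_Cauchy_converges_AE:
  assumes g: "\<And>k. g k \<in> L2 M"
    and d: "\<And>k. ip M (\<lambda>x. g (Suc k) x - g k x) (\<lambda>x. g (Suc k) x - g k x) \<le> (1 / 4) ^ k"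
  shows "AE x in M. convergent (\<lambda>k. g k x)"
proof -
  let ?d = "\<lambda>k x. g (Suc k) x - g k x"
  have [measurable]: "g k \<in> borel_measurable M" for k using g by (rule L2_measurable)
  have dL: "?d k \<in> L2 M" for k by (intro L2_diff g)
  have nn: "(\<integral>\<^sup>+ x. ennreal (2 ^ k * (?d k x)\<^sup>2) \<partial>M) \<le> ennreal ((1 / 2) ^ k)" for k
  proof -
    have "(\<integral>\<^sup>+ x. ennreal (2 ^ k * (?d k x)\<^sup>2) \<partial>M) = ennreal (\<integral> x. 2 ^ k * (?d k x)\<^sup>2 \<partial>M)"
      using dL[of k] by (intro nn_integral_eq_integral) (auto simp: L2_def)
    also have "(\<integral> x. 2 ^ k * (?d k x)\<^sup>2 \<partial>M) = 2 ^ k * ip M (?d k) (?d k)"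
      by (simp add: ip_def power2_eq_square)
    also have "ennreal \<dots> \<le> ennreal (2 ^ k * (1 / 4) ^ k)"
      using d[of k] by (intro ennreal_leI mult_left_mono) auto
    also have "(2::real) ^ k * (1 / 4) ^ k = (1 / 2) ^ k"
      by (simp flip: power_mult_distrib)
    finally show ?thesis .
  qed
  have "(\<integral>\<^sup>+ x. (\<Sum>k. ennreal (2 ^ k * (?d k x)\<^sup>2)) \<partial>M)
      = (\<Sum>k. \<integral>\<^sup>+ x. ennreal (2 ^ k * (?d k x)\<^sup>2) \<partial>M)"
    by (intro nn_integral_suminf) measurable
  also have "\<dots> \<le> (\<Sum>k. ennreal ((1 / 2) ^ k))"
    by (intro suminf_le nn) auto
  also have "\<dots> = ennreal (\<Sum>k. (1 / 2) ^ k)"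
    by (intro suminf_ennreal2) auto
  finally have "(\<integral>\<^sup>+ x. (\<Sum>k. ennreal (2 ^ k * (?d k x)\<^sup>2)) \<partial>M) \<noteq> \<infinity>"
    by (auto simp: top_unique)
  then have "AE x in M. (\<Sum>k. ennreal (2 ^ k * (?d k x)\<^sup>2)) \<noteq> \<infinity>"
    by (intro nn_integral_PInf_AE) measurable
  then show ?thesis
  proof (rule AE_mp, intro AE_I2 impI)
    fix x assume fin: "(\<Sum>k. ennreal (2 ^ k * (?d k x)\<^sup>2)) \<noteq> \<infinity>"
    have "summable (\<lambda>k. 2 ^ k * (?d k x)\<^sup>2)"
      by (rule summable_suminf_not_top) (use fin in auto)
    then have "Bseq (\<lambda>k. 2 ^ k * (?d k x)\<^sup>2)"
      using summable_LIMSEQ_zero convergent_imp_Bseq convergentI by blast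
    then obtain K where K: "K > 0" "\<And>k. norm (2 ^ k * (?d k x)\<^sup>2) \<le> K"
      by (auto elim: BseqE)
    have "\<bar>?d k x\<bar> \<le> sqrt K * sqrt (1 / 2) ^ k" for k
    proof (rule power2_le_imp_le)
      have "2 ^ k * (?d k x)\<^sup>2 \<le> K" using K(2)[of k] by simp
      then have "(?d k x)\<^sup>2 \<le> K * (1 / 2) ^ k"
        by (simp add: power_one_over field_simps)
      also have "\<dots> = (sqrt K * sqrt (1 / 2) ^ k)\<^sup>2"
        using K(1) by (simp add: power_mult_distrib power_mult[symmetric] mult.commute[of k 2] del: real_sqrt_divide)
          (simp add: power_mult del: real_sqrt_divide)
      finally show "\<bar>?d k x\<bar>\<^sup>2 \<le> (sqrt K * sqrt (1 / 2) ^ k)\<^sup>2" by simp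
      show "0 \<le> sqrt K * sqrt (1 / 2) ^ k" using K(1) by simp
    qed
    then have "\<And>k. k \<ge> 0 \<Longrightarrow> norm (?d k x) \<le> sqrt K * sqrt (1 / 2) ^ k" by simp
    moreover have "summable (\<lambda>k. sqrt K * sqrt (1 / 2) ^ k)"
      by (intro summable_mult summable_geometric) (simp add: real_sqrt_divide)
    ultimately have "summable (\<lambda>k. ?d k x)"
      by (rule summable_comparison_test'[rotated])
    then have "convergent (\<lambda>n. \<Sum>k<n. ?d k x)"
      by (simp add: summable_iff_convergent)
    then have "convergent (\<lambda>n. (g n x - g 0 x) + g 0 x)"
      by (subst (asm) sum_lessThan_telescope) (rule convergent_add[OF _ convergent_const])
    then show "convergent (\<lambda>k. g k x)" by simp
  qed
qed

text \<open>Riesz-Fischer: a fast subsequence converges a.e., and Fatou's lemma turns the Cauchy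
  bound between \<open>g i\<close> and the subsequence into a bound between \<open>g i\<close> and
  the pointwise limit. Completeness is what later produces the image of a vector under \<integral>
  \<phi> dP.\<close>

lemma L2_complete:
  assumes g: "\<And>k. g k \<in> L2 M"
    and C: "\<And>e. e > 0 \<Longrightarrow>
      \<exists>N. \<forall>i\<ge>N. \<forall>j\<ge>N. ip M (\<lambda>x. g i x - g j x) (\<lambda>x. g i x - g j x) < e"
  obtains f where "f \<in> L2 M" "L2_tendsto M g f"
proof -
  have [measurable]: "g k \<in> borel_measurable M" for k using g by (rule L2_measurable)
  obtain N where N: "\<And>k i j. i \<ge> N k \<Longrightarrow> j \<ge> N k \<Longrightarrow>
      ip M (\<lambda>x. g i x - g j x) (\<lambda>x. g i x - g j x) < (1 / 4) ^ k"
    using C[of "(1 / 4) ^ k" for k] by (metis zero_less_divide_1_iff zero_less_numeral zero_less_power)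
  \<comment> \<open>\<open>N\<close> need not be monotone. The maximum puts both \<open>r k\<close>
    and \<open>r (Suc k)\<close> beyond \<open>N k\<close>, so the k-th increment is below (1/4)^k;
    the summand k makes the subsequence pass every index.\<close>
  define r where "r k = Max (N ` {..k}) + k" for k
  have rN: "r k \<ge> N k" for k
    unfolding r_def by (intro trans_le_add1 Max_ge) auto
  have rk: "r k \<ge> k" for k by (simp add: r_def)
  have rSuc: "r (Suc k) \<ge> N k" for k
    unfolding r_def by (intro trans_le_add1 Max_ge) auto
  have "AE x in M. convergent (\<lambda>k. g (r k) x)"
    using g by (rule L2_fast_Cauchy_converges_AE) (intro less_imp_le N rN rSuc)
  moreover define f where "f x = lim (\<lambda>k. g (r k) x)" for x
  ultimately have lim: "AE x in M. (\<lambda>k. g (r k) x) \<longlonglongrightarrow> f x"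
    by (auto simp: convergent_LIMSEQ_iff)
  have [measurable]: "f \<in> borel_measurable M"
    unfolding f_def by (rule borel_measurable_lim_metric) measurable
  have Fatou: "(\<integral>\<^sup>+ x. ennreal ((g i x - f x)\<^sup>2) \<partial>M) \<le> ennreal e"
    if i: "i \<ge> n" and n: "\<And>i j. i \<ge> n \<Longrightarrow> j \<ge> n \<Longrightarrow>
      ip M (\<lambda>x. g i x - g j x) (\<lambda>x. g i x - g j x) < e" for i n e
  proof -
    have "(\<integral>\<^sup>+ x. ennreal ((g i x - f x)\<^sup>2) \<partial>M)
        = (\<integral>\<^sup>+ x. liminf (\<lambda>k. ennreal ((g i x - g (r k) x)\<^sup>2)) \<partial>M)"
    proof (rule nn_integral_cong_AE, rule AE_mp[OF lim], intro AE_I2 impI)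
      fix x assume "(\<lambda>k. g (r k) x) \<longlonglongrightarrow> f x"
      then have "(\<lambda>k. ennreal ((g i x - g (r k) x)\<^sup>2)) \<longlonglongrightarrow> ennreal ((g i x - f x)\<^sup>2)"
        by (intro tendsto_ennrealI tendsto_intros)
      then show "ennreal ((g i x - f x)\<^sup>2) = liminf (\<lambda>k. ennreal ((g i x - g (r k) x)\<^sup>2))"
        by (rule lim_imp_Liminf[OF trivial_limit_sequentially, symmetric])
    qed
    also have "\<dots> \<le> liminf (\<lambda>k. \<integral>\<^sup>+ x. ennreal ((g i x - g (r k) x)\<^sup>2) \<partial>M)"
      by (rule nn_integral_liminf) measurable
    also have "\<dots> \<le> liminf (\<lambda>k. ennreal e)"
    proof (rule Liminf_mono, rule eventually_sequentiallyI)
      fix k assume "n \<le> k"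
      then have "r k \<ge> n" using rk[of k] by linarith
      then have "ip M (\<lambda>x. g i x - g (r k) x) (\<lambda>x. g i x - g (r k) x) \<le> e"
        using n i by (simp add: less_imp_le)
      moreover have "(\<integral>\<^sup>+ x. ennreal ((g i x - g (r k) x)\<^sup>2) \<partial>M)
          = ennreal (ip M (\<lambda>x. g i x - g (r k) x) (\<lambda>x. g i x - g (r k) x))"
        unfolding ip_def power2_eq_square
        by (intro nn_integral_eq_integral L2_integrable_mult L2_diff g) simp
      ultimately show "(\<integral>\<^sup>+ x. ennreal ((g i x - g (r k) x)\<^sup>2) \<partial>M) \<le> ennreal e"
        by (simp add: ennreal_leI)
    qed
    also have "\<dots> = ennreal e" by (rule Liminf_const) simp
    finally show ?thesis .
  qed
  have diffL: "(\<lambda>x. g i x - f x) \<in> L2 M"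
    if "(\<integral>\<^sup>+ x. ennreal ((g i x - f x)\<^sup>2) \<partial>M) \<le> ennreal e" for i e
  proof -
    have "(\<integral>\<^sup>+ x. ennreal ((g i x - f x)\<^sup>2) \<partial>M) < \<infinity>"
      using that by (rule le_less_trans) simp
    then show ?thesis by (auto simp: L2_def integrable_iff_bounded)
  qed
  have f: "f \<in> L2 M"
  proof -
    \<comment> \<open>Beyond \<open>N 0\<close> the Cauchy bound is (1/4)^0 = 1, so
      \<open>g (N 0)\<close> has finite distance from f.\<close>
    have "(\<lambda>x. g (N 0) x - f x) \<in> L2 M"
      using diffL Fatou[of "N 0" "N 0"] N[where k = 0] by blast
    then have "(\<lambda>x. g (N 0) x - (g (N 0) x - f x)) \<in> L2 M"
      by (rule L2_diff[OF g])
    then show ?thesis by simp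
  qed
  moreover have "L2_tendsto M g f"
    unfolding L2_tendsto_def
  proof (rule LIMSEQ_I)
    fix e :: real assume "0 < e"
    then obtain n where n: "\<forall>i\<ge>n. \<forall>j\<ge>n. ip M (\<lambda>x. g i x - g j x) (\<lambda>x. g i x - g j x) < e / 2"
      using C[of "e / 2"] by auto
    have "ip M (\<lambda>x. g i x - f x) (\<lambda>x. g i x - f x) \<le> e / 2" if "i \<ge> n" for i
    proof -
      have "(\<integral>\<^sup>+ x. ennreal ((g i x - f x)\<^sup>2) \<partial>M) \<le> ennreal (e / 2)"
        using Fatou[OF that] n by blast
      also have "(\<integral>\<^sup>+ x. ennreal ((g i x - f x)\<^sup>2) \<partial>M)
          = ennreal (ip M (\<lambda>x. g i x - f x) (\<lambda>x. g i x - f x))"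
        unfolding ip_def power2_eq_square
        by (intro nn_integral_eq_integral L2_integrable_mult L2_diff g f) simp
      finally show ?thesis using \<open>0 < e\<close> by simp
    qed
    then have "norm (ip M (\<lambda>x. g i x - f x) (\<lambda>x. g i x - f x) - 0) < e" if "i \<ge> n" for i
      using \<open>0 < e\<close> that ip_self_nonneg[of M "\<lambda>x. g i x - f x"] by force
    then show "\<exists>n. \<forall>i\<ge>n. norm (ip M (\<lambda>x. g i x - f x) (\<lambda>x. g i x - f x) - 0) < e"
      by blast
  qed
  ultimately show ?thesis by (rule that)
qed

section \<open>Projection-valued measures\<close>

locale pvm =
  fixes M :: "'a measure" and P :: "real set \<Rightarrow> ('a \<Rightarrow> real) \<Rightarrow> ('a \<Rightarrow> real)"
  assumes pvm: "projection_valued_measure M P"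
begin

text \<open>The scalar spectral measure of a vector, not the signed measure of the Schroedinger
  form.\<close>

abbreviation \<mu> :: "('a \<Rightarrow> real) \<Rightarrow> real measure" where
  "\<mu> \<equiv> spectral_measure M P"

lemma proj_L2 [intro]: "B \<in> sets borel \<Longrightarrow> f \<in> L2 M \<Longrightarrow> P B f \<in> L2 M"
  using pvm by (auto simp: projection_valued_measure_def)

lemma proj_symmetric:
  "B \<in> sets borel \<Longrightarrow> f \<in> L2 M \<Longrightarrow> g \<in> L2 M \<Longrightarrow> ip M (P B f) g = ip M f (P B g)"
  using pvm unfolding projection_valued_measure_def by blast

lemma proj_UNIV: "f \<in> L2 M \<Longrightarrow> AE x in M. P UNIV f x = f x"
  using pvm by (auto simp: projection_valued_measure_def)

lemma proj_Int:
  "B \<in> sets borel \<Longrightarrow> C \<in> sets borel \<Longrightarrow> f \<in> L2 M \<Longrightarrow> AE x in M. P (B \<inter> C) f x = P B (P C f) x"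
  using pvm unfolding projection_valued_measure_def by blast

lemma proj_UN:
  "range B \<subseteq> sets borel \<Longrightarrow> disjoint_family B \<Longrightarrow> f \<in> L2 M \<Longrightarrow>
    L2_tendsto M (\<lambda>n x. \<Sum>i<n. P (B i) f x) (P (\<Union>i. B i) f)"
  using pvm unfolding projection_valued_measure_def by blast

lemma ip_proj_proj:
  assumes "B \<in> sets borel" "C \<in> sets borel" "f \<in> L2 M" "g \<in> L2 M"
  shows "ip M (P B f) (P C g) = ip M (P (B \<inter> C) f) g"
proof -
  have "ip M (P B f) (P C g) = ip M (P C (P B f)) g"
    using assms by (intro proj_symmetric[symmetric]) auto
  also have "\<dots> = ip M (P (C \<inter> B) f) g"
    using assms proj_Int[of C B f] by (intro ip_cong_AE) auto
  finally show ?thesis by (simp add: Int_commute)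
qed

lemma ip_proj_self:
  assumes "B \<in> sets borel" "f \<in> L2 M"
  shows "ip M (P B f) f = ip M (P B f) (P B f)"
  using ip_proj_proj[of B B f f] assms by simp

lemma ip_proj_nonneg: "B \<in> sets borel \<Longrightarrow> f \<in> L2 M \<Longrightarrow> 0 \<le> ip M (P B f) f"
  by (simp add: ip_proj_self ip_self_nonneg)

text \<open>Countable additivity for the constant family {} says that n p converges to p = P {} f,
  so (n - 1)^2 <p,p> tends to 0 and p vanishes.\<close>

lemma ip_proj_empty:
  assumes f: "f \<in> L2 M"
  shows "ip M (P {} f) f = 0"
proof -
  let ?p = "P {} f"
  have p: "?p \<in> L2 M" using f by auto
  have "L2_tendsto M (\<lambda>n x. \<Sum>i<n. ?p x) ?p"
    using proj_UN[of "\<lambda>_. {}" f] f by (simp add: disjoint_family_on_def)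
  moreover have "ip M (\<lambda>x. (\<Sum>i<n. ?p x) - ?p x) (\<lambda>x. (\<Sum>i<n. ?p x) - ?p x)
      = (real n - 1)\<^sup>2 * ip M ?p ?p" for n
  proof -
    have "(\<lambda>x. (\<Sum>i<n. ?p x) - ?p x) = (\<lambda>x. (real n - 1) * ?p x)"
      by (simp add: algebra_simps)
    then show ?thesis by (simp add: ip_linear power2_eq_square)
  qed
  ultimately have lim: "(\<lambda>n. (real n - 1)\<^sup>2 * ip M ?p ?p) \<longlonglongrightarrow> 0"
    by (simp add: L2_tendsto_def)
  have "1 * ip M ?p ?p \<le> (real n - 1)\<^sup>2 * ip M ?p ?p" if "n \<ge> 2" for n
    using that by (intro mult_right_mono ip_self_nonneg) simp
  then have "ip M ?p ?p \<le> 0"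
    using LIMSEQ_le_const[OF lim] by auto
  then show ?thesis
    using ip_self_nonneg[of M ?p] f by (simp add: ip_proj_self)
qed

section \<open>Scalar spectral measures\<close>

lemma sets_spectral [simp, measurable_cong]: "sets (\<mu> f) = sets borel"
  unfolding spectral_measure_def
  by (subst sets_measure_of) (auto simp: sets.sigma_sets_eq[of borel, simplified])

lemma space_spectral [simp]: "space (\<mu> f) = UNIV"
  by (simp add: spectral_measure_def)

text \<open>\<open>measure_of\<close> keeps the prescribed values only for a countably additive set
  function. Additivity comes from the L2 convergence in \<open>proj_UN\<close>, tested against f
  itself.\<close>

lemma emeasure_spectral:
  assumes f: "f \<in> L2 M" and B: "B \<in> sets borel"
  shows "emeasure (\<mu> f) B = ennreal (ip M (P B f) f)"
proof (rule emeasure_measure_of[OF spectral_measure_def])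
  show "sets borel \<subseteq> Pow (UNIV :: real set)" by simp
  show "B \<in> sets (\<mu> f)" using B by simp
  show "positive (sets (\<mu> f)) (\<lambda>B. ennreal (ip M (P B f) f))"
    by (simp add: positive_def ip_proj_empty f)
  show "countably_additive (sets (\<mu> f)) (\<lambda>B. ennreal (ip M (P B f) f))"
  proof (rule countably_additiveI)
    fix A :: "nat \<Rightarrow> real set"
    assume A: "range A \<subseteq> sets (\<mu> f)" "disjoint_family A"
    then have A': "range A \<subseteq> sets borel" by simp
    then have AL: "P (A i) f \<in> L2 M" for i using f by auto
    have U: "P (\<Union>i. A i) f \<in> L2 M" using A' f by (intro proj_L2) auto
    have "(\<lambda>n. ip M (\<lambda>x. \<Sum>i<n. P (A i) f x) f) \<longlonglongrightarrow> ip M (P (\<Union>i. A i) f) f"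
      using AL U f by (intro L2_tendsto_ip proj_UN A' A(2) L2_sum) auto
    then have "(\<lambda>i. ip M (P (A i) f) f) sums ip M (P (\<Union>i. A i) f) f"
      using AL f by (simp add: sums_def ip_sum_left)
    then show "(\<Sum>i. ennreal (ip M (P (A i) f) f)) = ennreal (ip M (P (\<Union>i. A i) f) f)"
      using A' f by (intro suminf_ennreal_eq ip_proj_nonneg) auto
  qed
qed

lemma measure_spectral:
  "f \<in> L2 M \<Longrightarrow> B \<in> sets borel \<Longrightarrow> measure (\<mu> f) B = ip M (P B f) f"
  by (simp add: measure_def emeasure_spectral ip_proj_nonneg)

lemma finite_spectral: "f \<in> L2 M \<Longrightarrow> finite_measure (\<mu> f)"
  by (rule finite_measureI) (simp add: emeasure_spectral)

lemma measure_spectral_UNIV: "f \<in> L2 M \<Longrightarrow> measure (\<mu> f) UNIV = ip M f f"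
  using proj_UNIV[of f] by (simp add: measure_spectral ip_cong_AE[of "P UNIV f" M f f] proj_L2)

text \<open>Multiplicativity and symmetry reduce <P B P C f, P C f> to <P (B \<inter> C) f, f>.
  Projecting a vector thus restricts its spectral measure, which makes all truncation arguments
  below work.\<close>

lemma spectral_proj:
  assumes f: "f \<in> L2 M" and C: "C \<in> sets borel"
  shows "\<mu> (P C f) = density (\<mu> f) (indicator C)"
proof (rule measure_eqI)
  fix B assume "B \<in> sets (\<mu> (P C f))"
  then have B: "B \<in> sets borel" by simp
  have "ip M (P B (P C f)) (P C f) = ip M (P (B \<inter> C) f) (P C f)"
    using proj_Int[OF B C f] B C f by (intro ip_cong_AE) auto
  also have "\<dots> = ip M (P (B \<inter> C) f) f"
    using ip_proj_proj[of "B \<inter> C" C f f] B C f by (simp add: Int_assoc)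
  finally show "emeasure (\<mu> (P C f)) B = emeasure (density (\<mu> f) (indicator C)) B"
    using B C f by (subst emeasure_density)
      (auto simp: emeasure_spectral proj_L2 indicator_inter_arith[symmetric] Int_commute)
qed simp

lemma integrable_spectral_proj:
  fixes \<phi> :: "real \<Rightarrow> real"
  assumes "f \<in> L2 M" "C \<in> sets borel" "\<phi> \<in> borel_measurable borel"
  shows "integrable (\<mu> (P C f)) \<phi> \<longleftrightarrow> integrable (\<mu> f) (\<lambda>l. indicator C l * \<phi> l)"
proof -
  have "density (\<mu> f) (indicator C) = density (\<mu> f) (\<lambda>l. ennreal (indicator C l))"
    by (simp add: ennreal_indicator)
  then show ?thesis using assms
    by (simp add: spectral_proj integrable_real_density)
qed

lemma integral_spectral_proj:
  fixes \<phi> :: "real \<Rightarrow> real"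
  assumes "f \<in> L2 M" "C \<in> sets borel" "\<phi> \<in> borel_measurable borel"
  shows "integral\<^sup>L (\<mu> (P C f)) \<phi> = (\<integral>l. indicator C l * \<phi> l \<partial>\<mu> f)"
proof -
  have "density (\<mu> f) (indicator C) = density (\<mu> f) (\<lambda>l. ennreal (indicator C l))"
    by (simp add: ennreal_indicator)
  then show ?thesis using assms
    by (simp add: spectral_proj integral_real_density)
qed

lemma ip_proj_add:
  assumes "B \<in> sets borel" "f \<in> L2 M" "g \<in> L2 M"
  shows "ip M (P B (\<lambda>x. f x + g x)) (\<lambda>x. f x + g x)
    = ip M (P B f) f + 2 * ip M (P B f) g + ip M (P B g) g"
proof -
  \<comment> \<open>Additivity of \<open>P B\<close> in weak form: symmetry moves \<open>P B\<close>
    to the test function h.\<close>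
  have *: "ip M (P B (\<lambda>x. f x + g x)) h = ip M (P B f) h + ip M (P B g) h" if "h \<in> L2 M" for h
    using assms that by (simp add: proj_symmetric ip_linear L2_intros proj_L2)
  show ?thesis
    using assms by (simp add: * ip_add_right L2_intros proj_L2
      proj_symmetric[of B g f] ip_commute[of M g "P B f"])
qed

lemma ip_proj_diff:
  assumes "B \<in> sets borel" "f \<in> L2 M" "g \<in> L2 M"
  shows "ip M (P B (\<lambda>x. f x - g x)) (\<lambda>x. f x - g x)
    = ip M (P B f) f - 2 * ip M (P B f) g + ip M (P B g) g"
proof -
  have *: "ip M (P B (\<lambda>x. f x - g x)) h = ip M (P B f) h - ip M (P B g) h" if "h \<in> L2 M" for h
    using assms that by (simp add: proj_symmetric ip_linear L2_intros proj_L2)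
  show ?thesis
    using assms by (simp add: * ip_diff_right L2_intros proj_L2
      proj_symmetric[of B g f] ip_commute[of M g "P B f"])
qed

text \<open>The cross terms 2 <P B f, g> cancel between the sum and the difference, so sums of
  vectors can be treated without complex or signed measures.\<close>

lemma emeasure_spectral_parallelogram:
  assumes "f \<in> L2 M" "g \<in> L2 M" "B \<in> sets borel"
  shows "emeasure (\<mu> (\<lambda>x. f x + g x)) B + emeasure (\<mu> (\<lambda>x. f x - g x)) B
    = 2 * emeasure (\<mu> f) B + 2 * emeasure (\<mu> g) B"
proof -
  have nn: "0 \<le> ip M (P B h) h" if "h \<in> L2 M" for h
    using assms that by (simp add: ip_proj_nonneg)
  have two: "2 * ennreal c = ennreal (2 * c)" for c
    by (metis ennreal_mult' ennreal_numeral zero_le_numeral)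
  show ?thesis
    using assms nn[of f] nn[of g] nn[OF L2_add[OF assms(1,2)]] nn[OF L2_diff[OF assms(1,2)]]
    by (simp add: emeasure_spectral L2_intros two ennreal_plus[symmetric] ip_proj_add ip_proj_diff
          del: ennreal_plus)
qed

text \<open>Passes from indicators to non-negative Borel functions by monotone approximation. Since
  infinite values are allowed, it applies to vectors not yet known to lie in any domain.\<close>

lemma nn_integral_spectral_parallelogram:
  assumes f: "f \<in> L2 M" "g \<in> L2 M" and u: "u \<in> borel_measurable borel"
  shows "(\<integral>\<^sup>+ l. u l \<partial>\<mu> (\<lambda>x. f x + g x)) + (\<integral>\<^sup>+ l. u l \<partial>\<mu> (\<lambda>x. f x - g x))
    = 2 * (\<integral>\<^sup>+ l. u l \<partial>\<mu> f) + 2 * (\<integral>\<^sup>+ l. u l \<partial>\<mu> g)"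
  using u
proof (induction rule: borel_measurable_induct)
  case (cong u v)
  then show ?case by simp
next
  case (set A)
  then show ?case using emeasure_spectral_parallelogram[OF f] by simp
next
  case (mult u c)
  have "c * (\<integral>\<^sup>+ l. u l \<partial>\<mu> (\<lambda>x. f x + g x)) + c * (\<integral>\<^sup>+ l. u l \<partial>\<mu> (\<lambda>x. f x - g x))
      = c * (2 * (\<integral>\<^sup>+ l. u l \<partial>\<mu> f) + 2 * (\<integral>\<^sup>+ l. u l \<partial>\<mu> g))"
    by (simp only: mult distrib_left[symmetric])
  with mult(2) show ?case
    by (simp add: nn_integral_cmult distrib_left ac_simps)
next
  case (add u v)
  then show ?case by (simp add: nn_integral_add algebra_simps)
next
  case (seq U)
  let ?I = "\<lambda>N. \<integral>\<^sup>+ l. (SUP i. U i) l \<partial>N"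
  have lim: "(\<lambda>i. integral\<^sup>N (\<mu> h) (U i)) \<longlonglongrightarrow> ?I (\<mu> h)" for h
  proof -
    have "?I (\<mu> h) = (\<integral>\<^sup>+ l. (SUP i. U i l) \<partial>\<mu> h)" by (simp only: SUP_apply)
    also have "\<dots> = (SUP i. integral\<^sup>N (\<mu> h) (U i))"
      using seq(1,3) by (intro nn_integral_monotone_convergence_SUP) auto
    finally have "?I (\<mu> h) = (SUP i. integral\<^sup>N (\<mu> h) (U i))" .
    moreover have "incseq (\<lambda>i. integral\<^sup>N (\<mu> h) (U i))"
      using seq(3) by (auto simp: incseq_def le_fun_def intro!: nn_integral_mono)
    ultimately show ?thesis by (simp add: LIMSEQ_SUP)
  qed
  have two: "(\<lambda>i. 2 * integral\<^sup>N (\<mu> h) (U i)) \<longlonglongrightarrow> 2 * ?I (\<mu> h)" for h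
    by (intro ennreal_tendsto_cmult lim) simp
  have "(\<lambda>i. integral\<^sup>N (\<mu> (\<lambda>x. f x + g x)) (U i) + integral\<^sup>N (\<mu> (\<lambda>x. f x - g x)) (U i))
      \<longlonglongrightarrow> 2 * ?I (\<mu> f) + 2 * ?I (\<mu> g)"
    unfolding seq.IH by (intro tendsto_add two)
  then show ?case by (rule LIMSEQ_unique[OF tendsto_add[OF lim lim]])
qed

text \<open>One of the two non-negative terms of the parallelogram law is dropped. Here the factor 2
  of the final domination arises.\<close>

lemma nn_integral_spectral_le:
  assumes "f \<in> L2 M" "g \<in> L2 M" "u \<in> borel_measurable borel"
  shows "(\<integral>\<^sup>+ l. u l \<partial>\<mu> (\<lambda>x. f x + g x)) \<le> 2 * (\<integral>\<^sup>+ l. u l \<partial>\<mu> f) + 2 * (\<integral>\<^sup>+ l. u l \<partial>\<mu> g)"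
    and "(\<integral>\<^sup>+ l. u l \<partial>\<mu> (\<lambda>x. f x - g x)) \<le> 2 * (\<integral>\<^sup>+ l. u l \<partial>\<mu> f) + 2 * (\<integral>\<^sup>+ l. u l \<partial>\<mu> g)"
  unfolding nn_integral_spectral_parallelogram[OF assms, symmetric] by simp_all


section \<open>Spectral calculus for simple functions\<close>

text \<open>The operator \<integral> \<phi> dP, written over the level sets of \<phi>; meaningful
  only when the range of \<phi> is finite.\<close>

definition simple_op :: "(real \<Rightarrow> real) \<Rightarrow> ('a \<Rightarrow> real) \<Rightarrow> 'a \<Rightarrow> real" where
  "simple_op \<phi> f = (\<lambda>x. \<Sum>c\<in>range \<phi>. c * P (\<phi> -` {c}) f x)"

lemma simple_vimage: "simple_function borel \<phi> \<Longrightarrow> \<phi> -` {c} \<in> sets borel"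
  using simple_functionD(2)[of borel \<phi> "{c}"] by simp

lemma simple_finite_range: "simple_function borel \<phi> \<Longrightarrow> finite (range \<phi>)"
  using simple_functionD(1)[of borel \<phi>] by simp

lemma simple_op_L2: "simple_function borel \<phi> \<Longrightarrow> f \<in> L2 M \<Longrightarrow> simple_op \<phi> f \<in> L2 M"
  unfolding simple_op_def by (intro L2_intros proj_L2 simple_vimage)

lemma ip_simple_op:
  assumes "simple_function borel \<phi>" "f \<in> L2 M" "h \<in> L2 M"
  shows "ip M (simple_op \<phi> f) h = (\<Sum>c\<in>range \<phi>. c * ip M (P (\<phi> -` {c}) f) h)"
  unfolding simple_op_def using assms
  by (simp add: ip_sum_left L2_scale proj_L2 simple_vimage ip_scale_left)

lemma simple_expansion:
  fixes \<phi> :: "real \<Rightarrow> real"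
  assumes "simple_function borel \<phi>"
  shows "\<phi> l = (\<Sum>c\<in>range \<phi>. c * indicator (\<phi> -` {c}) l)"
proof -
  have "(\<Sum>c\<in>range \<phi>. c * indicator (\<phi> -` {c}) l) = (\<Sum>c\<in>range \<phi>. if c = \<phi> l then c else 0)"
    by (intro sum.cong) (auto simp: indicator_def)
  also have "\<dots> = \<phi> l"
    using simple_finite_range[OF assms] by (subst sum.delta) auto
  finally show ?thesis by simp
qed

lemma integrable_spectral_indicator:
  "f \<in> L2 M \<Longrightarrow> B \<in> sets borel \<Longrightarrow> integrable (\<mu> f) (indicator B :: real \<Rightarrow> real)"
  by (simp add: integrable_indicator_iff emeasure_spectral)

lemma integral_spectral_simple:
  assumes "simple_function borel \<phi>" "f \<in> L2 M"
  shows "integral\<^sup>L (\<mu> f) \<phi> = (\<Sum>c\<in>range \<phi>. c * ip M (P (\<phi> -` {c}) f) f)"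
proof -
  have "integral\<^sup>L (\<mu> f) \<phi> = (\<integral>l. (\<Sum>c\<in>range \<phi>. c * indicator (\<phi> -` {c}) l) \<partial>\<mu> f)"
    by (intro Bochner_Integration.integral_cong refl simple_expansion assms)
  also have "\<dots> = (\<Sum>c\<in>range \<phi>. c * measure (\<mu> f) (\<phi> -` {c}))"
    using assms
    by (subst Bochner_Integration.integral_sum)
      (auto intro!: integrable_spectral_indicator simple_vimage)
  finally show ?thesis using assms by (simp add: measure_spectral simple_vimage)
qed

lemma ip_simple_op_self:
  "simple_function borel \<phi> \<Longrightarrow> f \<in> L2 M \<Longrightarrow> ip M (simple_op \<phi> f) f = integral\<^sup>L (\<mu> f) \<phi>"
  by (simp add: ip_simple_op integral_spectral_simple)

text \<open>On each level set the diagonal terms of f + h and f - h cancel and 4 <P B f, h> remains.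
  The right-hand side is the one that defines \<open>spectral_integral\<close>, so it survives the
  limit from simple to Borel functions.\<close>

lemma ip_simple_op_polarization:
  assumes \<phi>: "simple_function borel \<phi>" and "f \<in> L2 M" "h \<in> L2 M"
  shows "ip M (simple_op \<phi> f) h
    = (integral\<^sup>L (\<mu> (\<lambda>x. f x + h x)) \<phi> - integral\<^sup>L (\<mu> (\<lambda>x. f x - h x)) \<phi>) / 4"
  using assms
  by (simp add: ip_simple_op integral_spectral_simple L2_intros ip_proj_add ip_proj_diff
      simple_vimage sum_subtractf[symmetric] sum_divide_distrib right_diff_distrib[symmetric])

text \<open>Level sets of \<phi> and \<psi> meet in the sets on which \<phi> \<psi> is constant, and
  P B P C = P (B \<inter> C). For \<phi> = \<psi> this is the isometry that carries Cauchy sequences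
  from the spectral measure to L2.\<close>

lemma ip_simple_op_simple_op:
  assumes \<phi>: "simple_function borel \<phi>" and \<psi>: "simple_function borel \<psi>" and f: "f \<in> L2 M"
  shows "ip M (simple_op \<phi> f) (simple_op \<psi> f) = (\<integral>l. \<phi> l * \<psi> l \<partial>\<mu> f)"
proof -
  have ind: "integrable (\<mu> f) (indicator (\<phi> -` {c} \<inter> \<psi> -` {d}) :: real \<Rightarrow> real)" for c d
    by (intro integrable_spectral_indicator sets.Int simple_vimage assms)
  have "ip M (simple_op \<phi> f) (simple_op \<psi> f)
      = (\<Sum>c\<in>range \<phi>. \<Sum>d\<in>range \<psi>. c * (d * ip M (P (\<phi> -` {c}) f) (P (\<psi> -` {d}) f)))"
    unfolding ip_simple_op[OF \<phi> f simple_op_L2[OF \<psi> f]] sum_distrib_left[symmetric]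
    using \<phi> \<psi> f
    by (simp add: ip_commute[of M _ "simple_op \<psi> f"] ip_simple_op simple_vimage proj_L2)
      (simp add: ip_commute)
  also have "\<dots> = (\<Sum>c\<in>range \<phi>. \<Sum>d\<in>range \<psi>. c * (d * measure (\<mu> f) (\<phi> -` {c} \<inter> \<psi> -` {d})))"
    using \<phi> \<psi> f by (simp add: ip_proj_proj simple_vimage measure_spectral sets.Int)
  also have "\<dots> = (\<integral>l. (\<Sum>c\<in>range \<phi>. \<Sum>d\<in>range \<psi>.
      c * (d * indicator (\<phi> -` {c} \<inter> \<psi> -` {d}) l)) \<partial>\<mu> f)"
    by (simp add: ind Bochner_Integration.integral_sum Bochner_Integration.integrable_sum)
  also have "\<dots> = (\<integral>l. \<phi> l * \<psi> l \<partial>\<mu> f)"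
  proof (intro Bochner_Integration.integral_cong refl)
    fix l
    have "\<phi> l * \<psi> l = (\<Sum>c\<in>range \<phi>. c * indicator (\<phi> -` {c}) l) * (\<Sum>d\<in>range \<psi>. d * indicator (\<psi> -` {d}) l)"
      by (simp only: simple_expansion[OF \<phi>, symmetric] simple_expansion[OF \<psi>, symmetric])
    then show "(\<Sum>c\<in>range \<phi>. \<Sum>d\<in>range \<psi>. c * (d * indicator (\<phi> -` {c} \<inter> \<psi> -` {d}) l)) = \<phi> l * \<psi> l"
      by (simp only: sum_product indicator_inter_arith mult_ac)
  qed
  finally show ?thesis .
qed

section \<open>Spectral integrals of Borel functions: domain, existence, uniqueness\<close>

lemma mem_spectral_domain_iff:
  assumes "\<phi> \<in> borel_measurable borel"
  shows "f \<in> spectral_domain M P \<phi> \<longleftrightarrow> f \<in> L2 M \<and> (\<integral>\<^sup>+ l. ennreal ((\<phi> l)\<^sup>2) \<partial>\<mu> f) < \<infinity>"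
  using assms by (auto simp: spectral_domain_def integrable_iff_bounded)

lemma spectral_domain_L2: "f \<in> spectral_domain M P \<phi> \<Longrightarrow> f \<in> L2 M"
  by (simp add: spectral_domain_def)

lemma
  assumes \<phi>: "\<phi> \<in> borel_measurable borel"
    and f: "f \<in> spectral_domain M P \<phi>" and g: "g \<in> spectral_domain M P \<phi>"
  shows spectral_domain_add: "(\<lambda>x. f x + g x) \<in> spectral_domain M P \<phi>"
    and spectral_domain_diff: "(\<lambda>x. f x - g x) \<in> spectral_domain M P \<phi>"
proof -
  let ?u = "\<lambda>l. ennreal ((\<phi> l)\<^sup>2)"
  have u: "?u \<in> borel_measurable borel" using \<phi> by measurable
  have "2 * integral\<^sup>N (\<mu> f) ?u + 2 * integral\<^sup>N (\<mu> g) ?u < \<infinity>"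
    using f g \<phi> by (simp add: mem_spectral_domain_iff ennreal_mult_less_top)
  then show "(\<lambda>x. f x + g x) \<in> spectral_domain M P \<phi>" "(\<lambda>x. f x - g x) \<in> spectral_domain M P \<phi>"
    using f g \<phi> nn_integral_spectral_le[OF _ _ u, of f g]
    by (auto simp: mem_spectral_domain_iff L2_intros intro: le_less_trans)
qed

text \<open>The supply of domain vectors: the spectral measure of P C f is finite and carried by C,
  where \<phi> is bounded.\<close>

lemma proj_in_spectral_domain:
  assumes f: "f \<in> L2 M" and C: "C \<in> sets borel" and \<phi>: "\<phi> \<in> borel_measurable borel"
    and K: "\<And>l. l \<in> C \<Longrightarrow> \<bar>\<phi> l\<bar> \<le> K"
  shows "P C f \<in> spectral_domain M P \<phi>"
proof -
  interpret finite_measure "\<mu> f" using f by (rule finite_spectral)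
  have "integrable (\<mu> f) (\<lambda>l. indicator C l * (\<phi> l)\<^sup>2)"
  proof (rule integrable_const_bound)
    have "(\<phi> l)\<^sup>2 \<le> K\<^sup>2" if "l \<in> C" for l
      using power_mono[OF K[OF that] abs_ge_zero, of 2] by simp
    then show "AE l in \<mu> f. norm (indicator C l * (\<phi> l)\<^sup>2) \<le> K\<^sup>2"
      by (auto simp: indicator_def)
    show "(\<lambda>l. indicator C l * (\<phi> l)\<^sup>2) \<in> borel_measurable (\<mu> f)"
      using C \<phi> by measurable
  qed
  then show ?thesis using f C \<phi>
    by (simp add: spectral_domain_def proj_L2 integrable_spectral_proj)
qed

lemma spectral_domain_integrable:
  assumes "f \<in> spectral_domain M P \<phi>" "\<phi> \<in> borel_measurable borel"
  shows "integrable (\<mu> f) \<phi>"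
proof -
  interpret finite_measure "\<mu> f" using assms by (intro finite_spectral spectral_domain_L2)
  show ?thesis
  proof (rule Bochner_Integration.integrable_bound)
    show "integrable (\<mu> f) (\<lambda>l. 1 + (\<phi> l)\<^sup>2)"
      using assms by (simp add: spectral_domain_def)
    have "\<bar>y\<bar> \<le> 1 + y\<^sup>2" for y :: real
    proof -
      have "0 \<le> (\<bar>y\<bar> - 1 / 2)\<^sup>2" by simp
      then have "\<bar>y\<bar> \<le> 1 / 4 + y\<^sup>2" by (simp add: power2_eq_square algebra_simps)
      then show ?thesis by linarith
    qed
    then show "AE l in \<mu> f. norm (\<phi> l) \<le> norm (1 + (\<phi> l)\<^sup>2)" by simp
    show "\<phi> \<in> borel_measurable (\<mu> f)" using assms(2) by measurable
  qed
qed

text \<open>Simple approximations of \<phi> converge in L2 of the spectral measure by dominated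
  convergence, so by the isometry their images of f are Cauchy. The limit g inherits the norm, the
  quadratic form and the polarized identities from the simple case.\<close>

lemma spectral_integral_exists:
  assumes \<phi>: "\<phi> \<in> borel_measurable borel" and f: "f \<in> spectral_domain M P \<phi>"
  obtains g where "(f, g) \<in> spectral_integral M P \<phi>"
    "ip M g g = (\<integral>l. (\<phi> l)\<^sup>2 \<partial>\<mu> f)" "ip M g f = (\<integral>l. \<phi> l \<partial>\<mu> f)"
proof -
  note [measurable] = \<phi>
  have fL: "f \<in> L2 M" using f by (rule spectral_domain_L2)
  obtain F where F: "\<And>i. simple_function borel (F i)" "\<And>l. (\<lambda>i. F i l) \<longlonglongrightarrow> \<phi> l"
    and bound0: "\<And>i l. dist (F i l) 0 \<le> 2 * dist (\<phi> l) 0"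
    using borel_measurable_implies_sequence_metric[OF \<phi>, of 0] by auto
  have bound: "\<bar>F i l\<bar> \<le> 2 * \<bar>\<phi> l\<bar>" for i l using bound0[of i l] by (simp add: dist_norm)
  have [measurable]: "F i \<in> borel_measurable borel" for i
    using F(1) by (rule borel_measurable_simple_function)
  have sq: "(F i l)\<^sup>2 \<le> 4 * (\<phi> l)\<^sup>2" for i l
    using power_mono[OF bound abs_ge_zero, of i l 2] by (simp add: power_mult_distrib)
  have int2: "integrable (\<mu> f) (\<lambda>l. (\<phi> l)\<^sup>2)"
    using f by (simp add: spectral_domain_def)
  have FL: "simple_op (F i) f \<in> L2 M" for i by (rule simple_op_L2[OF F(1) fL])
  let ?e = "\<lambda>i. \<integral>l. (F i l - \<phi> l)\<^sup>2 \<partial>\<mu> f"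
  have sq_diff: "(a - b)\<^sup>2 \<le> 2 * a\<^sup>2 + 2 * b\<^sup>2" for a b :: real
    using zero_le_power2[of "a + b"] by (simp add: power2_eq_square algebra_simps)
  \<comment> \<open>The constant is 2 * 4 + 2, as (F i)^2 is at most 4 \<phi>^2.\<close>
  have d_bound: "(F i l - \<phi> l)\<^sup>2 \<le> 10 * (\<phi> l)\<^sup>2" for i l
    using sq_diff[of "F i l" "\<phi> l"] sq[of i l] by simp
  have e_int: "integrable (\<mu> f) (\<lambda>l. (F i l - \<phi> l)\<^sup>2)" for i
    by (rule Bochner_Integration.integrable_bound[OF integrable_mult_right[OF int2, of 10]])
      (use d_bound in auto)
  have prod_int: "integrable (\<mu> f) (\<lambda>l. F i l * F j l)" for i j
  proof (rule Bochner_Integration.integrable_bound[OF integrable_mult_right[OF int2, of 4]])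
    have "\<bar>F i l\<bar> * \<bar>F j l\<bar> \<le> (2 * \<bar>\<phi> l\<bar>) * (2 * \<bar>\<phi> l\<bar>)" for l
      by (intro mult_mono bound) auto
    then show "AE l in \<mu> f. norm (F i l * F j l) \<le> norm (4 * (\<phi> l)\<^sup>2)"
      by (simp add: abs_mult power2_eq_square)
  qed measurable
  have e_lim: "?e \<longlonglongrightarrow> 0"
  proof -
    have "?e \<longlonglongrightarrow> (\<integral>l. 0 \<partial>\<mu> f)"
    proof (rule integral_dominated_convergence[where w = "\<lambda>l. 10 * (\<phi> l)\<^sup>2"])
      have "(\<lambda>i. (F i l - \<phi> l)\<^sup>2) \<longlonglongrightarrow> (\<phi> l - \<phi> l)\<^sup>2" for l
        by (intro tendsto_intros F)
      then show "AE l in \<mu> f. (\<lambda>i. (F i l - \<phi> l)\<^sup>2) \<longlonglongrightarrow> 0" by simp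
    qed (use int2 d_bound in auto)
    then show ?thesis by simp
  qed
  have diff: "ip M (\<lambda>x. simple_op (F i) f x - simple_op (F j) f x)
      (\<lambda>x. simple_op (F i) f x - simple_op (F j) f x) \<le> 2 * ?e i + 2 * ?e j" for i j
  proof -
    have "ip M (\<lambda>x. simple_op (F i) f x - simple_op (F j) f x)
        (\<lambda>x. simple_op (F i) f x - simple_op (F j) f x)
        = (\<integral>l. F i l * F i l - 2 * (F i l * F j l) + F j l * F j l \<partial>\<mu> f)"
      by (simp add: ip_diff_self FL ip_simple_op_simple_op F(1) fL prod_int)
    also have "\<dots> \<le> (\<integral>l. 2 * (F i l - \<phi> l)\<^sup>2 + 2 * (F j l - \<phi> l)\<^sup>2 \<partial>\<mu> f)"
    proof (rule integral_mono)
      fix l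
      show "F i l * F i l - 2 * (F i l * F j l) + F j l * F j l
          \<le> 2 * (F i l - \<phi> l)\<^sup>2 + 2 * (F j l - \<phi> l)\<^sup>2"
        using sq_diff[of "F i l - \<phi> l" "F j l - \<phi> l"] by (simp add: power2_eq_square algebra_simps)
    qed (simp_all add: prod_int e_int)
    also have "\<dots> = 2 * ?e i + 2 * ?e j" by (simp add: e_int)
    finally show ?thesis .
  qed
  obtain g where g: "g \<in> L2 M" and lim: "L2_tendsto M (\<lambda>i. simple_op (F i) f) g"
  proof (rule L2_complete[of "\<lambda>i. simple_op (F i) f" M])
    fix e :: real assume "e > 0"
    then obtain N where N: "\<And>i. i \<ge> N \<Longrightarrow> norm (?e i - 0) < e / 4"
      using LIMSEQ_D[OF e_lim, of "e / 4"] by auto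
    show "\<exists>N. \<forall>i\<ge>N. \<forall>j\<ge>N. ip M (\<lambda>x. simple_op (F i) f x - simple_op (F j) f x)
        (\<lambda>x. simple_op (F i) f x - simple_op (F j) f x) < e"
    proof (intro exI allI impI)
      fix i j assume "N \<le> i" "N \<le> j"
      then show "ip M (\<lambda>x. simple_op (F i) f x - simple_op (F j) f x)
          (\<lambda>x. simple_op (F i) f x - simple_op (F j) f x) < e"
        using diff[of i j] N[of i] N[of j] by (simp add: abs_less_iff)
    qed
  qed (rule FL)
  have int_lim: "(\<lambda>i. integral\<^sup>L (\<mu> h) (F i)) \<longlonglongrightarrow> integral\<^sup>L (\<mu> h) \<phi>"
    if "h \<in> spectral_domain M P \<phi>" for h
    by (rule integral_dominated_convergence[where w = "\<lambda>l. 2 * \<bar>\<phi> l\<bar>"])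
      (use spectral_domain_integrable[OF that \<phi>] bound F(2) in auto)
  show ?thesis
  proof
    show "ip M g g = (\<integral>l. (\<phi> l)\<^sup>2 \<partial>\<mu> f)"
    proof (rule LIMSEQ_unique)
      show "(\<lambda>i. ip M (simple_op (F i) f) (simple_op (F i) f)) \<longlonglongrightarrow> ip M g g"
        by (rule L2_tendsto_ip_self[OF FL g lim])
      have "(\<lambda>i. \<integral>l. F i l * F i l \<partial>\<mu> f) \<longlonglongrightarrow> (\<integral>l. (\<phi> l)\<^sup>2 \<partial>\<mu> f)"
      proof (rule integral_dominated_convergence[where w = "\<lambda>l. 4 * (\<phi> l)\<^sup>2"])
        show "AE l in \<mu> f. (\<lambda>i. F i l * F i l) \<longlonglongrightarrow> (\<phi> l)\<^sup>2"
          unfolding power2_eq_square by (intro AE_I2 tendsto_intros F)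
      qed (use int2 sq in \<open>auto simp: power2_eq_square abs_mult\<close>)
      then show "(\<lambda>i. ip M (simple_op (F i) f) (simple_op (F i) f)) \<longlonglongrightarrow> (\<integral>l. (\<phi> l)\<^sup>2 \<partial>\<mu> f)"
        by (simp add: ip_simple_op_simple_op F(1) fL)
    qed
    show "ip M g f = (\<integral>l. \<phi> l \<partial>\<mu> f)"
    proof (rule LIMSEQ_unique)
      show "(\<lambda>i. ip M (simple_op (F i) f) f) \<longlonglongrightarrow> ip M g f"
        by (rule L2_tendsto_ip[OF FL g fL lim])
      show "(\<lambda>i. ip M (simple_op (F i) f) f) \<longlonglongrightarrow> (\<integral>l. \<phi> l \<partial>\<mu> f)"
        using int_lim[OF f] by (simp add: ip_simple_op_self F(1) fL)
    qed
    have "ip M g h = ((\<integral>l. \<phi> l \<partial>\<mu> (\<lambda>x. f x + h x)) - (\<integral>l. \<phi> l \<partial>\<mu> (\<lambda>x. f x - h x))) / 4"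
      if h: "h \<in> spectral_domain M P \<phi>" for h
    proof (rule LIMSEQ_unique)
      have hL: "h \<in> L2 M" using h by (rule spectral_domain_L2)
      show "(\<lambda>i. ip M (simple_op (F i) f) h) \<longlonglongrightarrow> ip M g h"
        by (rule L2_tendsto_ip[OF FL g hL lim])
      have "(\<lambda>i. (integral\<^sup>L (\<mu> (\<lambda>x. f x + h x)) (F i)
          - integral\<^sup>L (\<mu> (\<lambda>x. f x - h x)) (F i)) / 4)
        \<longlonglongrightarrow> (integral\<^sup>L (\<mu> (\<lambda>x. f x + h x)) \<phi> - integral\<^sup>L (\<mu> (\<lambda>x. f x - h x)) \<phi>) / 4"
        by (intro tendsto_intros int_lim spectral_domain_add spectral_domain_diff \<phi> f h) simp
      then show "(\<lambda>i. ip M (simple_op (F i) f) h) \<longlonglongrightarrow>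
          (integral\<^sup>L (\<mu> (\<lambda>x. f x + h x)) \<phi> - integral\<^sup>L (\<mu> (\<lambda>x. f x - h x)) \<phi>) / 4"
        by (simp add: ip_simple_op_polarization[OF F(1) fL hL])
    qed
    then show "(f, g) \<in> spectral_integral M P \<phi>"
      using f g by (simp add: spectral_integral_def)
  qed
qed

lemma Domain_spectral_integral:
  assumes "\<phi> \<in> borel_measurable borel"
  shows "Domain (spectral_integral M P \<phi>) = spectral_domain M P \<phi>"
proof
  show "Domain (spectral_integral M P \<phi>) \<subseteq> spectral_domain M P \<phi>"
    by (auto simp: spectral_integral_def)
  show "spectral_domain M P \<phi> \<subseteq> Domain (spectral_integral M P \<phi>)"
    using spectral_integral_exists[OF assms] by blast
qed

lemma spectral_integral_L2:
  "(f, g) \<in> spectral_integral M P \<phi> \<Longrightarrow> g \<in> L2 M"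
  by (simp add: spectral_integral_def)

text \<open>The graph condition prescribes <g,h> in terms of f for every h in the domain, so d = g -
  g' is orthogonal to the domain. Testing with the projection of d to {\<bar>\<phi>\<bar> \<le> n}
  shows that the spectral measure of d gives this set mass 0; these sets exhaust the line.\<close>

lemma spectral_integral_unique:
  assumes \<phi>: "\<phi> \<in> borel_measurable borel"
    and g: "(f, g) \<in> spectral_integral M P \<phi>" and g': "(f, g') \<in> spectral_integral M P \<phi>"
  shows "AE x in M. g x = g' x"
proof -
  note [measurable] = \<phi>
  let ?d = "\<lambda>x. g x - g' x"
  have L: "g \<in> L2 M" "g' \<in> L2 M" "?d \<in> L2 M"
    using g g' by (auto intro: spectral_integral_L2 L2_diff)
  interpret finite_measure "\<mu> ?d" by (rule finite_spectral[OF L(3)])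
  let ?C = "\<lambda>n::nat. {l. \<bar>\<phi> l\<bar> \<le> real n}"
  have C: "?C n \<in> sets borel" for n by measurable
  have "measure (\<mu> ?d) (?C n) = 0" for n
  proof -
    have "P (?C n) ?d \<in> spectral_domain M P \<phi>"
      by (rule proj_in_spectral_domain[OF L(3) C \<phi>, where K = "real n"]) simp
    then have "ip M g (P (?C n) ?d) = ip M g' (P (?C n) ?d)"
      using g g' unfolding spectral_integral_def mem_Collect_eq case_prod_conv by metis
    then have "ip M ?d (P (?C n) ?d) = 0"
      using L C by (simp add: ip_diff_left proj_L2)
    then show ?thesis using L C by (simp add: measure_spectral ip_commute)
  qed
  moreover have "(\<lambda>n. measure (\<mu> ?d) (?C n)) \<longlonglongrightarrow> measure (\<mu> ?d) (\<Union>n. ?C n)"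
    using C by (intro finite_Lim_measure_incseq) (auto simp: incseq_def)
  moreover have "(\<Union>n. ?C n) = UNIV"
    using real_arch_simple by auto
  ultimately have "measure (\<mu> ?d) UNIV = 0"
    by (simp add: LIMSEQ_const_iff)
  then have "AE x in M. ?d x = 0"
    using L by (intro ip_self_eq_0) (simp_all add: measure_spectral_UNIV)
  then show ?thesis by simp
qed

text \<open>Both identities hold for one image of f by construction; uniqueness transfers them to
  any image.\<close>

lemma
  assumes \<phi>: "\<phi> \<in> borel_measurable borel" and g: "(f, g) \<in> spectral_integral M P \<phi>"
  shows ip_spectral_integral_self: "ip M g g = (\<integral>l. (\<phi> l)\<^sup>2 \<partial>\<mu> f)"
    and ip_spectral_integral: "ip M g f = (\<integral>l. \<phi> l \<partial>\<mu> f)"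
proof -
  have f: "f \<in> spectral_domain M P \<phi>" using g by (simp add: spectral_integral_def)
  obtain g' where g': "(f, g') \<in> spectral_integral M P \<phi>"
    "ip M g' g' = (\<integral>l. (\<phi> l)\<^sup>2 \<partial>\<mu> f)" "ip M g' f = (\<integral>l. \<phi> l \<partial>\<mu> f)"
    using spectral_integral_exists[OF \<phi> f] .
  have L: "g \<in> L2 M" "g' \<in> L2 M" "f \<in> L2 M"
    using g g'(1) f by (auto intro: spectral_integral_L2 spectral_domain_L2)
  have eq: "ip M g h = ip M g' h" if "h \<in> L2 M" for h
    using spectral_integral_unique[OF \<phi> g g'(1)] L that by (intro ip_cong_AE) auto
  show "ip M g f = (\<integral>l. \<phi> l \<partial>\<mu> f)" using eq[OF L(3)] g'(3) by simp
  show "ip M g g = (\<integral>l. (\<phi> l)\<^sup>2 \<partial>\<mu> f)"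
    using eq[OF L(1)] eq[OF L(2)] g'(2) by (simp add: ip_commute)
qed

end

text \<open>If the spectral measure of f charged a set of numbers at most -c < 0, the projection of
  f to a bounded such set would have a negative quadratic form. This is shown for an arbitrary
  resolution, so that each one occurring later is known to live on [0,\<infinity>).\<close>

lemma (in pvm) spectral_support_nonneg:
  assumes nonneg: "\<And>f g. (f, g) \<in> spectral_integral M P (\<lambda>l. l) \<Longrightarrow> 0 \<le> ip M g f"
    and f: "f \<in> L2 M"
  shows "AE l in \<mu> f. 0 \<le> l"
proof -
  interpret finite_measure "\<mu> f" using f by (rule finite_spectral)
  \<comment> \<open>Bounded, so that the projection of f lies in the operator domain, and away from
    0, so that the integrand has a strictly negative upper bound. Their union is the negative
    half-line.\<close>
  define C :: "nat \<Rightarrow> real set" where "C n = {- real n..- (1 / (real n + 1))}" for n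
  have C: "C n \<in> sets borel" for n by (simp add: C_def)
  have "AE l in \<mu> f. l \<notin> C n" for n
  proof -
    have n1: "1 / (real n + 1) > 0" by simp
    have C_abs: "\<bar>l\<bar> \<le> real n" if "l \<in> C n" for l
    proof -
      have "- real n \<le> l" "l \<le> - (1 / (real n + 1))" using that by (auto simp: C_def)
      then show ?thesis using n1 by linarith
    qed
    have "P (C n) f \<in> spectral_domain M P (\<lambda>l. l)"
      by (rule proj_in_spectral_domain[OF f C _ C_abs]) simp_all
    then obtain g where "(P (C n) f, g) \<in> spectral_integral M P (\<lambda>l. l)"
      "ip M g (P (C n) f) = (\<integral>l. l \<partial>\<mu> (P (C n) f))"
      using spectral_integral_exists[of "\<lambda>l. l" "P (C n) f"] by auto
    then have "0 \<le> (\<integral>l. l \<partial>\<mu> (P (C n) f))"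
      using nonneg by force
    also have "\<dots> = (\<integral>l. indicator (C n) l * l \<partial>\<mu> f)"
      by (rule integral_spectral_proj[OF f C]) simp
    also have "\<dots> \<le> (\<integral>l. - (1 / (real n + 1)) * indicator (C n) l \<partial>\<mu> f)"
    proof (rule integral_mono)
      show "integrable (\<mu> f) (\<lambda>l. indicator (C n) l * l)"
        using C C_abs by (intro integrable_const_bound[where B = "real n"])
          (auto simp: indicator_def)
      show "integrable (\<mu> f) (\<lambda>l. - (1 / (real n + 1)) * indicator (C n) l)"
        by (intro integrable_mult_right integrable_spectral_indicator f C)
    qed (auto simp: indicator_def C_def)
    also have "\<dots> = - (1 / (real n + 1)) * measure (\<mu> f) (C n)" by simp
    finally have "(1 / (real n + 1)) * measure (\<mu> f) (C n) \<le> 0" by simp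
    then have "measure (\<mu> f) (C n) = 0"
      using n1 measure_nonneg[of "\<mu> f" "C n"] by (simp add: mult_le_0_iff divide_le_0_iff)
    then have "C n \<in> null_sets (\<mu> f)"
      using C by (simp add: null_sets_def emeasure_eq_measure)
    then show ?thesis by (rule AE_not_in)
  qed
  then have "AE l in \<mu> f. \<forall>n. l \<notin> C n" by (simp add: AE_all_countable)
  then show ?thesis
  proof (rule AE_mp, intro AE_I2 impI)
    fix l :: real assume *: "\<forall>n. l \<notin> C n"
    show "0 \<le> l"
    proof (rule ccontr)
      assume "\<not> 0 \<le> l"
      then have l: "- l > 0" by simp
      obtain n1 where n1: "- l \<le> real n1" using real_arch_simple by blast
      obtain n2 where n2: "inverse (real (Suc n2)) < - l" using reals_Archimedean[OF l] by blast
      have "1 / (real (max n1 n2) + 1) \<le> inverse (real (Suc n2))"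
        by (simp add: inverse_eq_divide frac_le)
      with n1 n2 have "l \<in> C (max n1 n2)" by (auto simp: C_def)
      with * show False by blast
    qed
  qed
qed

section \<open>Domination of the subordinate form\<close>

lemma neg_op_nonneg: "nonpos_op M L \<Longrightarrow> (f, g) \<in> neg_op L \<Longrightarrow> 0 \<le> ip M g f"
  by (auto simp: nonpos_op_def neg_op_def ip_def)

text \<open>The HOL function \<open>sqrt\<close> is odd, so this covers negative x. Form values
  therefore appear as integrals of \<bar>l\<bar> before the support is known to be
  non-negative.\<close>

lemma power2_sqrt_abs: "(sqrt x)\<^sup>2 = \<bar>x\<bar>"
  by (metis real_sqrt_abs real_sqrt_power)

lemma (in pvm) sqrt_form:
  assumes "D = Domain (spectral_integral M P sqrt)"
    and "\<forall>(f, f')\<in>spectral_integral M P sqrt. \<forall>(g, g')\<in>spectral_integral M P sqrt.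
      A f g = ip M f' g'"
  shows "D = spectral_domain M P sqrt"
    and "f \<in> D \<Longrightarrow> A f f = (\<integral>l. \<bar>l\<bar> \<partial>\<mu> f)"
proof -
  show D: "D = spectral_domain M P sqrt"
    using assms(1) by (simp add: Domain_spectral_integral)
  assume "f \<in> D"
  then obtain f' where f': "(f, f') \<in> spectral_integral M P sqrt"
    using assms(1) by auto
  then have "A f f = ip M f' f'" using assms(2) by fastforce
  then show "A f f = (\<integral>l. \<bar>l\<bar> \<partial>\<mu> f)"
    using ip_spectral_integral_self[OF _ f'] by (simp add: power2_sqrt_abs)
qed

text \<open>Pythagoras for the orthogonal projection \<open>P C\<close>; it makes truncation errors
  visible as spectral mass outside C.\<close>

lemma (in pvm) ip_diff_proj:
  assumes f: "f \<in> L2 M" and C: "C \<in> sets borel"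
  shows "ip M (\<lambda>x. f x - P C f x) (\<lambda>x. f x - P C f x) = ip M f f - measure (\<mu> f) C"
  using assms
  by (simp add: ip_diff_self proj_L2 measure_spectral ip_commute[of M f "P C f"] ip_proj_self)

lemma form_operatorE:
  assumes "form_operator M D A L"
  obtains P where "pvm M P" "nonpos_op M L" "neg_op L = spectral_integral M P (\<lambda>l. l)"
    "D = spectral_domain M P sqrt"
    "\<And>f. f \<in> D \<Longrightarrow> A f f = (\<integral>l. \<bar>l\<bar> \<partial>spectral_measure M P f)"
proof -
  obtain P where P: "projection_valued_measure M P" "nonpos_op M L"
    "neg_op L = spectral_integral M P (\<lambda>l. l)" "D = Domain (spectral_integral M P sqrt)"
    "\<forall>(f, f')\<in>spectral_integral M P sqrt. \<forall>(g, g')\<in>spectral_integral M P sqrt. A f g = ip M f' g'"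
    using assms unfolding form_operator_def functional_calculus_def by blast
  interpret pvm M P by (rule pvm.intro) (rule P)
  show ?thesis
    by (rule that[OF pvm_axioms P(2,3) sqrt_form(1)[OF P(4,5)] sqrt_form(2)[OF P(4,5)]])
qed

lemma form_operator_dom_diff:
  assumes "form_operator M D A L" "f \<in> D" "g \<in> D"
  shows "(\<lambda>x. f x - g x) \<in> D"
proof -
  obtain P where "pvm M P" "D = spectral_domain M P sqrt"
    by (rule form_operatorE[OF assms(1)])
  then show ?thesis using assms(2,3) pvm.spectral_domain_diff[of M P sqrt f g] by simp
qed

lemma form_operator_nonneg:
  assumes "form_operator M D A L" "f \<in> D"
  shows "0 \<le> A f f"
proof -
  obtain P where "A f f = (\<integral>l. \<bar>l\<bar> \<partial>spectral_measure M P f)"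
    using form_operatorE[OF assms(1)] assms(2) by metis
  then show ?thesis by simp
qed

text \<open>
  The spectral resolutions \<open>P1\<close>, \<open>P2\<close> of \<open>-L\<close> and \<open>P3\<close> of \<open>-L'\<close> are not identified with each
  other: only the operators \<open>-L\<close> and \<open>-L'\<close>, evaluated at the truncations \<open>P1[-n,n] f\<close>, are
  compared. Passing to the limit in \<open>n\<close> is done with \<open>\<parallel>a + b\<parallel>\<^sup>2 \<le> 2\<parallel>a\<parallel>\<^sup>2 + 2\<parallel>b\<parallel>\<^sup>2\<close>, whence the
  factor \<open>2\<close>.
\<close>

lemma subordinate_form_le:
  assumes sub: "form_operator M D A L" "functional_calculus M (neg_op L) \<Phi> (neg_op L')"
      "form_operator M D' A' L'"
    and \<Phi>: "\<Phi> \<in> borel_measurable borel" "\<And>l. 0 \<le> l \<Longrightarrow> 0 \<le> \<Phi> l" "\<And>l. 0 \<le> l \<Longrightarrow> \<Phi> l \<le> C * l"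
      "0 \<le> C"
    and f: "f \<in> D"
  shows "f \<in> D' \<and> A' f f \<le> 2 * (C * A f f)"
proof -
  obtain P1 where P1: "pvm M P1" "nonpos_op M L" "neg_op L = spectral_integral M P1 (\<lambda>l. l)"
    "D = spectral_domain M P1 sqrt"
    "\<And>f. f \<in> D \<Longrightarrow> A f f = (\<integral>l. \<bar>l\<bar> \<partial>spectral_measure M P1 f)"
    using form_operatorE[OF sub(1)] by blast
  obtain P2 where P2: "pvm M P2" "neg_op L = spectral_integral M P2 (\<lambda>l. l)"
    "neg_op L' = spectral_integral M P2 \<Phi>"
    using sub(2) unfolding functional_calculus_def pvm_def by blast
  obtain P3 where P3: "pvm M P3" "nonpos_op M L'" "neg_op L' = spectral_integral M P3 (\<lambda>l. l)"
    "D' = spectral_domain M P3 sqrt"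
    "\<And>f. f \<in> D' \<Longrightarrow> A' f f = (\<integral>l. \<bar>l\<bar> \<partial>spectral_measure M P3 f)"
    using form_operatorE[OF sub(3)] by blast
  interpret p1: pvm M P1 by (rule P1)
  interpret p2: pvm M P2 by (rule P2)
  interpret p3: pvm M P3 by (rule P3)
  note [measurable] = \<Phi>(1)
  have fL: "f \<in> L2 M" using f unfolding P1(4) by (rule p1.spectral_domain_L2)
  interpret m1: finite_measure "p1.\<mu> f" by (rule p1.finite_spectral[OF fL])
  have f_int: "integrable (p1.\<mu> f) (\<lambda>l. \<bar>l\<bar>)"
    using f by (simp add: P1(4) spectral_domain_def power2_sqrt_abs)
  have Aff: "0 \<le> C * A f f" using form_operator_nonneg[OF sub(1) f] \<Phi>(4) by simp
  \<comment> \<open>f is only in the domain of the square root of -L; cutting to a bounded spectral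
    interval puts \<open>?f n\<close> in the domain of -L itself.\<close>
  let ?I = "\<lambda>n::nat. {- real n..real n}"
  let ?f = "\<lambda>n. P1 (?I n) f"
  let ?d = "\<lambda>n x. f x - ?f n x"
  have fnL: "?f n \<in> L2 M" for n using fL by (intro p1.proj_L2) auto
  have dnL: "?d n \<in> L2 M" for n by (intro L2_diff fL fnL)
  \<comment> \<open>The chain is <-L' f_n, f_n> \<le> C <-L f_n, f_n> \<le> C A(f,f). The first
    inequality is read in \<open>P2\<close>, the second in \<open>P1\<close>, and the left-hand side
    is the integral against \<open>P3\<close>.\<close>
  have trunc: "(\<integral>\<^sup>+ l. ennreal \<bar>l\<bar> \<partial>p3.\<mu> (?f n)) \<le> ennreal (C * A f f)" for n
  proof -
    have "?f n \<in> spectral_domain M P1 (\<lambda>l. l)"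
      by (rule p1.proj_in_spectral_domain[OF fL, where K = "real n"]) auto
    then obtain g where g: "(?f n, g) \<in> neg_op L"
      unfolding P1(3) using p1.Domain_spectral_integral[of "\<lambda>l. l"] by auto
    have "ip M g (?f n) = (\<integral>l. l \<partial>p1.\<mu> (?f n))"
      by (rule p1.ip_spectral_integral) (use g P1(3) in auto)
    also have "\<dots> = (\<integral>l. indicator (?I n) l * l \<partial>p1.\<mu> f)"
      by (rule p1.integral_spectral_proj[OF fL]) auto
    also have "\<dots> \<le> (\<integral>l. \<bar>l\<bar> \<partial>p1.\<mu> f)"
    proof (rule integral_mono)
      show "integrable (p1.\<mu> f) (\<lambda>l. indicator (?I n) l * l)"
        by (rule Bochner_Integration.integrable_bound[OF f_int]) (auto simp: indicator_def)
    qed (auto simp: f_int indicator_def)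
    finally have g1: "ip M g (?f n) \<le> A f f" using P1(5)[OF f] by simp
    \<comment> \<open>The bounds on \<Phi> hold only for l \<ge> 0. \<open>P2\<close> resolves the
      same operator -L, whose non-negativity was obtained along with \<open>P1\<close>.\<close>
    have pos2: "AE l in p2.\<mu> (?f n). 0 \<le> l"
      by (rule p2.spectral_support_nonneg[OF _ fnL]) (rule neg_op_nonneg[OF P1(2)], simp add: P2(2))
    have dom2: "?f n \<in> spectral_domain M P2 (\<lambda>l. l)"
      using g p2.Domain_spectral_integral[of "\<lambda>l. l"] unfolding P2(2) by auto
    have "integrable (p2.\<mu> (?f n)) (\<lambda>l. (\<Phi> l)\<^sup>2)"
    proof (rule Bochner_Integration.integrable_bound)
      show "integrable (p2.\<mu> (?f n)) (\<lambda>l. C\<^sup>2 * l\<^sup>2)"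
        using dom2 by (simp add: spectral_domain_def)
      show "AE l in p2.\<mu> (?f n). norm ((\<Phi> l)\<^sup>2) \<le> norm (C\<^sup>2 * l\<^sup>2)"
        using pos2
      proof (rule AE_mp, intro AE_I2 impI)
        fix l :: real assume "0 \<le> l"
        then have "(\<Phi> l)\<^sup>2 \<le> (C * l)\<^sup>2" using \<Phi> by (intro power_mono) auto
        then show "norm ((\<Phi> l)\<^sup>2) \<le> norm (C\<^sup>2 * l\<^sup>2)" by (simp add: power_mult_distrib)
      qed
    qed measurable
    then have dom2': "?f n \<in> spectral_domain M P2 \<Phi>"
      using fnL by (simp add: spectral_domain_def)
    then obtain g' where g': "(?f n, g') \<in> neg_op L'"
      unfolding P2(3) using p2.Domain_spectral_integral[OF \<Phi>(1)] by auto
    have "ip M g' (?f n) = (\<integral>l. \<Phi> l \<partial>p2.\<mu> (?f n))"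
      by (rule p2.ip_spectral_integral) (use g' P2(3) in auto)
    also have "\<dots> \<le> (\<integral>l. C * l \<partial>p2.\<mu> (?f n))"
    proof (rule integral_mono_AE)
      show "integrable (p2.\<mu> (?f n)) \<Phi>"
        by (rule p2.spectral_domain_integrable[OF dom2' \<Phi>(1)])
      show "integrable (p2.\<mu> (?f n)) (\<lambda>l. C * l)"
        by (intro integrable_mult_right p2.spectral_domain_integrable[OF dom2]) simp
      show "AE l in p2.\<mu> (?f n). \<Phi> l \<le> C * l"
        using pos2 by (rule AE_mp) (intro AE_I2 impI \<Phi>)
    qed
    also have "\<dots> = C * ip M g (?f n)"
      using p2.ip_spectral_integral[of "\<lambda>l. l" "?f n" g] g P2(2) by simp
    also have "\<dots> \<le> C * A f f" by (intro mult_left_mono g1 \<Phi>)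
    finally have g'1: "ip M g' (?f n) \<le> C * A f f" .
    have pos3: "AE l in p3.\<mu> (?f n). 0 \<le> l"
      by (rule p3.spectral_support_nonneg[OF _ fnL]) (rule neg_op_nonneg[OF P3(2)], simp add: P3(3))
    have dom3: "?f n \<in> spectral_domain M P3 (\<lambda>l. l)"
      using g' p3.Domain_spectral_integral[of "\<lambda>l. l"] unfolding P3(3) by auto
    have "(\<integral>\<^sup>+ l. ennreal \<bar>l\<bar> \<partial>p3.\<mu> (?f n)) = (\<integral>\<^sup>+ l. ennreal l \<partial>p3.\<mu> (?f n))"
      using pos3 by (intro nn_integral_cong_AE) auto
    also have "\<dots> = ennreal (\<integral>l. l \<partial>p3.\<mu> (?f n))"
      using pos3 p3.spectral_domain_integrable[OF dom3] by (intro nn_integral_eq_integral) auto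
    also have "(\<integral>l. l \<partial>p3.\<mu> (?f n)) = ip M g' (?f n)"
      using p3.ip_spectral_integral[of "\<lambda>l. l" "?f n" g'] g' P3(3) by simp
    finally show ?thesis using g'1 by (simp add: ennreal_leI)
  qed
  have d_lim: "(\<lambda>n. ip M (?d n) (?d n)) \<longlonglongrightarrow> 0"
  proof -
    have "(\<lambda>n. measure (p1.\<mu> f) (?I n)) \<longlonglongrightarrow> measure (p1.\<mu> f) (\<Union>n. ?I n)"
      by (intro m1.finite_Lim_measure_incseq) (auto simp: incseq_def)
    moreover have "(\<Union>n. ?I n) = UNIV"
    proof -
      have "\<exists>n. l \<in> ?I n" for l :: real
        using real_arch_simple[of "\<bar>l\<bar>"] by (auto simp: abs_le_iff minus_le_iff)
      then show ?thesis by blast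
    qed
    ultimately have "(\<lambda>n. ip M f f - measure (p1.\<mu> f) (?I n)) \<longlonglongrightarrow> ip M f f - ip M f f"
      using fL by (intro tendsto_intros) (simp add: p1.measure_spectral_UNIV)
    then show ?thesis using fL by (simp add: p1.ip_diff_proj)
  qed
  \<comment> \<open>Nothing is known about the \<open>P3\<close> energy of the remainder
    \<open>?d n\<close>, only that its L2 norm vanishes. Capping the integrand at k bounds its
    contribution by k times the squared norm, so n can go to infinity with k fixed.\<close>
  have trunc_le: "(\<integral>\<^sup>+ l. ennreal (min \<bar>l\<bar> (real k)) \<partial>p3.\<mu> f) \<le> 2 * ennreal (C * A f f)" for k
  proof -
    let ?u = "\<lambda>l::real. ennreal (min \<bar>l\<bar> (real k))"
    have "(\<integral>\<^sup>+ l. ?u l \<partial>p3.\<mu> f)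
        \<le> 2 * ennreal (C * A f f) + 2 * ennreal (real k * ip M (?d n) (?d n))" for n
    proof -
      have "(\<integral>\<^sup>+ l. ?u l \<partial>p3.\<mu> f) = (\<integral>\<^sup>+ l. ?u l \<partial>p3.\<mu> (\<lambda>x. ?f n x + ?d n x))" by simp
      also have "\<dots> \<le> 2 * (\<integral>\<^sup>+ l. ?u l \<partial>p3.\<mu> (?f n)) + 2 * (\<integral>\<^sup>+ l. ?u l \<partial>p3.\<mu> (?d n))"
        by (rule p3.nn_integral_spectral_le(1)[OF fnL dnL]) measurable
      also have "\<dots> \<le> 2 * ennreal (C * A f f) + 2 * ennreal (real k * ip M (?d n) (?d n))"
      proof (intro add_mono mult_left_mono)
        have "(\<integral>\<^sup>+ l. ?u l \<partial>p3.\<mu> (?f n)) \<le> (\<integral>\<^sup>+ l. ennreal \<bar>l\<bar> \<partial>p3.\<mu> (?f n))"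
          by (intro nn_integral_mono ennreal_leI) simp
        also note trunc
        finally show "(\<integral>\<^sup>+ l. ?u l \<partial>p3.\<mu> (?f n)) \<le> ennreal (C * A f f)" .
        interpret m3: finite_measure "p3.\<mu> (?d n)" by (rule p3.finite_spectral[OF dnL])
        have "(\<integral>\<^sup>+ l. ?u l \<partial>p3.\<mu> (?d n)) \<le> (\<integral>\<^sup>+ l. ennreal (real k) \<partial>p3.\<mu> (?d n))"
          by (intro nn_integral_mono ennreal_leI) simp
        also have "\<dots> = ennreal (real k) * ennreal (ip M (?d n) (?d n))"
          using p3.measure_spectral_UNIV[OF dnL] by (simp add: m3.emeasure_eq_measure)
        also have "\<dots> = ennreal (real k * ip M (?d n) (?d n))"
          by (simp add: ennreal_mult ip_self_nonneg)
        finally show "(\<integral>\<^sup>+ l. ?u l \<partial>p3.\<mu> (?d n)) \<le> ennreal (real k * ip M (?d n) (?d n))" .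
      qed simp_all
      finally show ?thesis .
    qed
    moreover have "(\<lambda>n. 2 * ennreal (C * A f f) + 2 * ennreal (real k * ip M (?d n) (?d n)))
        \<longlonglongrightarrow> 2 * ennreal (C * A f f) + 2 * ennreal (real k * 0)"
      by (intro tendsto_add tendsto_const ennreal_tendsto_cmult tendsto_ennrealI tendsto_mult d_lim)
        simp
    ultimately show ?thesis
      using LIMSEQ_le_const by fastforce
  qed
  \<comment> \<open>The bound is uniform in k, so Fatou's lemma removes the cap.\<close>
  have "(\<integral>\<^sup>+ l. ennreal \<bar>l\<bar> \<partial>p3.\<mu> f)
      = (\<integral>\<^sup>+ l. liminf (\<lambda>k. ennreal (min \<bar>l\<bar> (real k))) \<partial>p3.\<mu> f)"
  proof (rule nn_integral_cong)
    fix l :: real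
    obtain k0 where "\<bar>l\<bar> \<le> real k0" using real_arch_simple by blast
    then have "\<forall>\<^sub>F k in sequentially. ennreal (min \<bar>l\<bar> (real k)) = ennreal \<bar>l\<bar>"
      by (intro eventually_sequentiallyI[of k0]) (auto simp: min_def)
    then have "(\<lambda>k. ennreal (min \<bar>l\<bar> (real k))) \<longlonglongrightarrow> ennreal \<bar>l\<bar>"
      by (rule tendsto_eventually)
    then show "ennreal \<bar>l\<bar> = liminf (\<lambda>k. ennreal (min \<bar>l\<bar> (real k)))"
      by (rule lim_imp_Liminf[OF trivial_limit_sequentially, symmetric])
  qed
  also have "\<dots> \<le> liminf (\<lambda>k. \<integral>\<^sup>+ l. ennreal (min \<bar>l\<bar> (real k)) \<partial>p3.\<mu> f)"
    by (rule nn_integral_liminf) measurable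
  also have "\<dots> \<le> liminf (\<lambda>k::nat. 2 * ennreal (C * A f f))"
    by (intro Liminf_mono always_eventually allI trunc_le)
  also have "\<dots> = 2 * ennreal (C * A f f)" by (rule Liminf_const) simp
  also have "\<dots> = ennreal (2 * (C * A f f))"
    using Aff by (simp add: ennreal_mult)
  finally have le: "(\<integral>\<^sup>+ l. ennreal \<bar>l\<bar> \<partial>p3.\<mu> f) \<le> ennreal (2 * (C * A f f))" .
  then have int3: "integrable (p3.\<mu> f) (\<lambda>l. \<bar>l\<bar>)"
    by (auto simp: integrable_iff_bounded intro: le_less_trans)
  then have fD': "f \<in> D'" using fL by (simp add: P3(4) spectral_domain_def power2_sqrt_abs)
  moreover have "A' f f \<le> 2 * (C * A f f)"
    using le Aff unfolding P3(5)[OF fD'] by (subst (asm) nn_integral_eq_integral[OF int3]) auto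
  ultimately show ?thesis ..
qed

section \<open>Bernstein functions with integrable Levy measure\<close>

text \<open>\<nu> may have infinite mass near 0, but compact intervals [1/(n+1), n] have finite mass
  and exhaust (0,\<infinity>). Sigma-finiteness gives the measurability of \<Phi> as a parameter
  integral.\<close>

lemma levy_pair_sigma_finite:
  assumes "levy_pair b \<nu>"
  shows "sigma_finite_measure \<nu>"
proof
  have \<nu>: "sets \<nu> = sets (restrict_space borel {0<..})"
    "\<And>K. compact K \<Longrightarrow> K \<subseteq> {0<..} \<Longrightarrow> emeasure \<nu> K < \<infinity>"
    using assms by (auto simp: levy_pair_def radon_on_def)
  have sp: "space \<nu> = {0<..}" using sets_eq_imp_space_eq[OF \<nu>(1)] by (simp add: space_restrict_space)
  let ?K = "\<lambda>n::nat. {inverse (real (Suc n))..real n}"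
  have sub: "?K n \<subseteq> {0<..}" for n
  proof
    fix x assume "x \<in> ?K n"
    moreover have "0 < inverse (real (Suc n))" by simp
    ultimately show "x \<in> {0<..}" by (simp del: inverse_positive_iff_positive)
  qed
  have "(\<Union>n. ?K n) = {0<..}"
  proof (intro equalityI subsetI)
    fix x :: real assume x: "x \<in> {0<..}"
    obtain n1 where n1: "x \<le> real n1" using real_arch_simple by blast
    obtain n2 where n2: "inverse (real (Suc n2)) < x" using reals_Archimedean x by auto
    have "inverse (real (Suc (max n1 n2))) \<le> inverse (real (Suc n2))"
      by (intro le_imp_inverse_le) auto
    with n2 have "inverse (real (Suc (max n1 n2))) \<le> x" by linarith
    with n1 have "x \<in> ?K (max n1 n2)" by (simp only: atLeastAtMost_iff) simp
    then show "x \<in> (\<Union>n. ?K n)" by blast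
  qed (use sub in blast)
  moreover have "?K n \<in> sets \<nu>" for n
    using sub[of n] unfolding \<nu>(1) by (subst sets_restrict_space_iff) auto
  moreover have "emeasure \<nu> (?K n) \<noteq> \<infinity>" for n
    using \<nu>(2)[OF _ sub] by (simp add: less_top[symmetric])
  ultimately show "\<exists>A. countable A \<and> A \<subseteq> sets \<nu> \<and> \<Union> A = space \<nu> \<and> (\<forall>a\<in>A. emeasure \<nu> a \<noteq> \<infinity>)"
    unfolding sp by (intro exI[of _ "range ?K"]) auto
qed

text \<open>Measurability is needed on the whole line, since spectral resolutions live there. For l
  < 0 the integral may diverge and then has the default value 0; the inequalities are stated for l
  \<ge> 0 only.\<close>

lemma
  assumes lp: "levy_pair b \<nu>" and fin: "(\<integral>\<^sup>+ s. ennreal s \<partial>\<nu>) < \<infinity>"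
  shows bernstein_measurable: "bernstein b \<nu> \<in> borel_measurable borel"
    and bernstein_nonneg: "0 \<le> l \<Longrightarrow> 0 \<le> bernstein b \<nu> l"
    and bernstein_le: "0 \<le> l \<Longrightarrow> bernstein b \<nu> l \<le> (b + (\<integral>s. s \<partial>\<nu>)) * l"
    and levy_mean_nonneg: "0 \<le> b + (\<integral>s. s \<partial>\<nu>)"
proof -
  interpret sigma_finite_measure \<nu> by (rule levy_pair_sigma_finite[OF lp])
  have b: "0 \<le> b" and sets: "sets \<nu> = sets (restrict_space borel {0<..})"
    using lp by (auto simp: levy_pair_def radon_on_def)
  have sp: "space \<nu> = {0<..}" using sets_eq_imp_space_eq[OF sets] by (simp add: space_restrict_space)
  have [measurable]: "(\<lambda>s. s) \<in> borel_measurable \<nu>"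
    using measurable_restrict_space1[OF measurable_ident, of borel "{0<..}"] sets
    by (simp add: measurable_cong_sets[OF sets refl] id_def)
  have s_int: "integrable \<nu> (\<lambda>s. s)"
  proof -
    have "(\<integral>\<^sup>+ s. ennreal (norm s) \<partial>\<nu>) = (\<integral>\<^sup>+ s. ennreal s \<partial>\<nu>)"
      by (intro nn_integral_cong) (simp add: sp)
    then show ?thesis using fin by (simp add: integrable_iff_bounded)
  qed
  have mean: "0 \<le> (\<integral>s. s \<partial>\<nu>)" by (rule Bochner_Integration.integral_nonneg) (simp add: sp)
  show "0 \<le> b + (\<integral>s. s \<partial>\<nu>)" using b mean by simp
  have "(\<lambda>l. \<integral>s. (1 - exp (- l * s)) \<partial>\<nu>) \<in> borel_measurable borel"
    by (rule borel_measurable_lebesgue_integral) measurable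
  then show "bernstein b \<nu> \<in> borel_measurable borel"
    unfolding bernstein_def[abs_def] by measurable
  assume l: "0 \<le> l"
  have nn: "0 \<le> 1 - exp (- l * s)" if "s \<in> space \<nu>" for s
    using l that by (simp add: sp)
  show "0 \<le> bernstein b \<nu> l"
    unfolding bernstein_def using b l nn
    by (intro add_nonneg_nonneg mult_nonneg_nonneg Bochner_Integration.integral_nonneg) auto
  have le: "1 - exp (- l * s) \<le> l * s" for s
    using exp_ge_add_one_self[of "- l * s"] by simp
  have "(\<integral>s. (1 - exp (- l * s)) \<partial>\<nu>) \<le> (\<integral>s. l * s \<partial>\<nu>)"
  proof (rule integral_mono)
    show "integrable \<nu> (\<lambda>s. 1 - exp (- l * s))"
    proof (rule Bochner_Integration.integrable_bound)
      show "integrable \<nu> (\<lambda>s. l * s)" using s_int by simp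
      show "AE s in \<nu>. norm (1 - exp (- l * s)) \<le> norm (l * s)"
        using nn le by (intro AE_I2) (simp add: order_trans[OF le abs_ge_self])
    qed measurable
  qed (use s_int le in auto)
  then show "bernstein b \<nu> l \<le> (b + (\<integral>s. s \<partial>\<nu>)) * l"
    unfolding bernstein_def by (simp add: algebra_simps)
qed

text \<open>The same h and the same sequence serve, since a.e. convergence does not involve the
  form. Domination is applied to the differences \<open>fn i - fn j\<close> as well, hence the
  closure of \<open>D\<close> under differences.\<close>

lemma critical_form_dominated:
  assumes diff: "\<And>f g. f \<in> D \<Longrightarrow> g \<in> D \<Longrightarrow> (\<lambda>x. f x - g x) \<in> D"
    and sub: "D \<subseteq> D'"
    and nonneg: "\<And>f. f \<in> D' \<Longrightarrow> 0 \<le> A' f f"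
    and le: "\<And>f. f \<in> D \<Longrightarrow> A' f f \<le> K * A f f" and K: "0 \<le> K"
    and crit: "critical_form M D A"
  shows "critical_form M D' A'"
proof -
  obtain h fn where h: "h \<in> borel_measurable M" "AE x in M. 0 < h x"
    and fn: "\<And>n. fn n \<in> D" "form_Cauchy A fn" "AE x in M. (\<lambda>n. fn n x) \<longlonglongrightarrow> h x"
    and lim: "(\<lambda>n. A (fn n) (fn n)) \<longlonglongrightarrow> 0"
    using crit
    unfolding critical_form_def extended_value_def extended_dom_def extended_seq_def by blast
  have "form_Cauchy A' fn"
    unfolding form_Cauchy_def
  proof (intro allI impI)
    fix e :: real assume e: "0 < e"
    \<comment> \<open>K may be 0, so the tolerance is divided by K + 1.\<close>
    have K1: "0 < K + 1" using K by simp
    obtain N where N: "\<And>i j. i \<ge> N \<Longrightarrow> j \<ge> N \<Longrightarrow>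
        A (\<lambda>x. fn i x - fn j x) (\<lambda>x. fn i x - fn j x) < e / (K + 1)"
      using fn(2) divide_pos_pos[OF e K1] unfolding form_Cauchy_def by metis
    have "A' (\<lambda>x. fn i x - fn j x) (\<lambda>x. fn i x - fn j x) < e" if "i \<ge> N" "j \<ge> N" for i j
    proof -
      have "A' (\<lambda>x. fn i x - fn j x) (\<lambda>x. fn i x - fn j x)
          \<le> K * A (\<lambda>x. fn i x - fn j x) (\<lambda>x. fn i x - fn j x)"
        by (intro le diff fn)
      also have "\<dots> \<le> K * (e / (K + 1))"
        using N[OF that] K by (intro mult_left_mono) auto
      also have "\<dots> < e" using e K by (simp add: field_simps)
      finally show ?thesis .
    qed
    then show "\<exists>N. \<forall>i\<ge>N. \<forall>j\<ge>N. A' (\<lambda>x. fn i x - fn j x) (\<lambda>x. fn i x - fn j x) < e" by blast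
  qed
  then have ext: "extended_seq M D' A' fn h"
    using fn sub by (auto simp: extended_seq_def)
  have "(\<lambda>n. A' (fn n) (fn n)) \<longlonglongrightarrow> 0"
  proof (rule tendsto_sandwich[where f = "\<lambda>_. 0"])
    show "\<forall>\<^sub>F n in sequentially. 0 \<le> A' (fn n) (fn n)"
      using nonneg fn(1) sub by (intro always_eventually) auto
    show "\<forall>\<^sub>F n in sequentially. A' (fn n) (fn n) \<le> K * A (fn n) (fn n)"
      using le fn(1) by (intro always_eventually) auto
    show "(\<lambda>n. K * A (fn n) (fn n)) \<longlonglongrightarrow> 0"
      using lim by (rule tendsto_mult_right_zero)
  qed auto
  then show ?thesis
    using h ext unfolding critical_form_def extended_value_def extended_dom_def by blast
qed

theorem proposition3p13:
  fixes m :: "'a::metric_space measure"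
    and D :: "('a \<Rightarrow> real) set" and \<E> :: "'a form"
    and \<mu>p \<mu>n :: "'a measure"
    and b :: real and \<nu> :: "real measure"
    and D\<Phi> :: "('a \<Rightarrow> real) set" and \<E>\<Phi> :: "'a form"
  assumes "locally_compact_space (euclidean :: 'a topology)"
    and "separable_space (euclidean :: 'a topology)"
    and "radon_on UNIV m" and "supp_measure m = UNIV"
    and "dirichlet_form m D \<E>" and "regular_form m D \<E>" and "irreducible_form m D \<E>"
    and "smooth_measure m D \<E> \<mu>p" and "radon_on UNIV \<mu>p"
    and "smooth_measure m D \<E> \<mu>n" and "radon_on UNIV \<mu>n"
    and "nonneg_form (D \<inter> Cc) (schroedinger_core_form \<E> \<mu>p \<mu>n)"
    and "closable_form m (D \<inter> Cc) (schroedinger_core_form \<E> \<mu>p \<mu>n)"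
    and "levy_pair b \<nu>"
    and "b > 0 \<or> Inf (ereal ` supp_measure \<nu>) = 0"
    and "subordinate_form m (bernstein b \<nu>)
           (schroedinger_dom m D \<E> \<mu>p \<mu>n) (schroedinger_form m D \<E> \<mu>p \<mu>n) D\<Phi> \<E>\<Phi>"
    and "critical_form m (schroedinger_dom m D \<E> \<mu>p \<mu>n) (schroedinger_form m D \<E> \<mu>p \<mu>n)"
    and "(\<integral>\<^sup>+ s. ennreal s \<partial>\<nu>) < \<infinity>"
  shows "critical_form m D\<Phi> \<E>\<Phi>"
proof -
  let ?S = "schroedinger_dom m D \<E> \<mu>p \<mu>n" and ?A = "schroedinger_form m D \<E> \<mu>p \<mu>n"
  note levy = assms(14) and mean = assms(18)
  obtain L L' where sub: "form_operator m ?S ?A L"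
      "functional_calculus m (neg_op L) (bernstein b \<nu>) (neg_op L')" "form_operator m D\<Phi> \<E>\<Phi> L'"
    using assms(16) unfolding subordinate_form_def by blast
  \<comment> \<open>The right derivative of \<Phi> at 0, finite by the first-moment
    condition.\<close>
  define C where "C = b + (\<integral>s. s \<partial>\<nu>)"
  have C: "0 \<le> C" unfolding C_def by (rule levy_mean_nonneg[OF levy mean])
  have le: "f \<in> D\<Phi> \<and> \<E>\<Phi> f f \<le> 2 * (C * ?A f f)" if "f \<in> ?S" for f
    using subordinate_form_le[OF sub bernstein_measurable[OF levy mean]
        bernstein_nonneg[OF levy mean] bernstein_le[OF levy mean, folded C_def] C that] .
  show ?thesis
  proof (rule critical_form_dominated[where K = "2 * C"])
    show "critical_form m ?S ?A" by (rule assms(17))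
  qed (use le C form_operator_dom_diff[OF sub(1)] form_operator_nonneg[OF sub(3)]
      in \<open>auto simp: mult.assoc\<close>)
qed

end
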